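(* Let $0<\alpha<1$, $\sigma>0$, $N_1>1$ an integer, $h=\sigma^2\alpha^2$, $T=\sigma\alpha\sqrt{N_1}$, $\kappa=\frac{\alpha}{1-\alpha}$. For $x\in(0,1]$ and complex $u\notin(-\infty,0]$ let $$f(u,x)=\frac{\sin(\alpha\pi)}{\alpha\pi}\frac{1}{2\sqrt u}\frac{xe^{\sqrt u-T}}{e^{\frac1\alpha(\sqrt u-T)}+x}$$ (principal branch of $\sqrt u$), and for real $u$ define $$\hat f(u,x)=\begin{cases}f(u,x),&u\ge h,\\ f(h,x),&-h\le u\le h,\\ f(-u,x),&u\le -h.\end{cases}$$ Let $u^*=\frac{1+(1-2\alpha)\sqrt{4\alpha-4\alpha^2+1}}{2(1-\alpha)^2}$, $\gamma=\alpha\log\!\Big(\frac{\frac1\kappa\sqrt{u^*}+1}{\sqrt{u^*}-1}\Big)+\sqrt{u^*}$, $x^*=e^{\frac1\alpha(\gamma-T)}$, and $$M_0=2\max\left\{\frac{\sigma^2}{4},\ 1+\mathrm{ceil}\!\left(\frac{9\pi^2}{\sigma^2}\right),\ 2\,\mathrm{ceil}\!\left[\left(1+\sqrt{\tfrac{\pi}{\sigma}}\right)^4\right]\right\}.$$ Let $\Upsilon$ be the set of $x\in[x^*,1]$ with $(T+\alpha\log x)^2-\alpha^2\pi^2>M_0h$. Then for $x\in\Upsilon$, $$\sum_{n\ne0}\mathfrak{F}[\hat f]\Big(\frac{2n\pi}{h}\Big)=e^{h}\,\mathcal{O}(e^{-T})+\mathcal{O}\!\left(\frac{x^\alpha}{e^{\frac{2\pi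 a}{h}}-1}\right),\qquad a=2\pi\alpha(T+\alpha\log x),$$ where the constants in the $\mathcal{O}$ terms are independent of $T$, $n$, $h$, $x$, $\alpha$ and $\sigma$.
   Context: $\mathfrak{F}[w](\xi)=\int_{-\infty}^{+\infty}w(u)e^{-i\xi u}\,\mathrm{d}u$ is the Fourier transform in $u$ (for fixed $x$). $\mathrm{ceil}(y)$ is the least integer $\ge y$. Note $x^*=\frac{\frac1\kappa\sqrt{u^*}+1}{\sqrt{u^*}-1}e^{\frac1\alpha(\sqrt{u^*}-T)}$. *)

theory Defs
  imports "HOL-Analysis.Analysis"
begin

definition fourier :: "(real \<Rightarrow> real) \<Rightarrow> real \<Rightarrow> complex" where
  "fourier w \<xi> = (LINT u|lborel. complex_of_real (w u) * exp (- (\<i> * complex_of_real (\<xi> * u))))"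

text \<open>f(u,x) for real u > 0 (principal square root of a positive real is the real square root).\<close>
definition fT :: "real \<Rightarrow> real \<Rightarrow> real \<Rightarrow> real \<Rightarrow> real" where
  "fT \<alpha> T x u = sin (\<alpha> * pi) / (\<alpha> * pi) * (1 / (2 * sqrt u)) *
     (x * exp (sqrt u - T) / (exp ((sqrt u - T) / \<alpha>) + x))"

definition fhat :: "real \<Rightarrow> real \<Rightarrow> real \<Rightarrow> real \<Rightarrow> real \<Rightarrow> real" where
  "fhat \<alpha> T h x u =
     (if h \<le> u then fT \<alpha> T x u
      else if - h \<le> u then fT \<alpha> T x h
      else fT \<alpha> T x (- u))"

definition ustar :: "real \<Rightarrow> real" where
  "ustar \<alpha> = (1 + (1 - 2 * \<alpha>) * sqrt (4 * \<alpha> - 4 * \<alpha>\<^sup>2 + 1)) / (2 * (1 - \<alpha>)\<^sup>2)"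

definition gammastar :: "real \<Rightarrow> real" where
  "gammastar \<alpha> = (let \<kappa> = \<alpha> / (1 - \<alpha>); s = sqrt (ustar \<alpha>) in
     \<alpha> * ln ((s / \<kappa> + 1) / (s - 1)) + s)"

definition xstar :: "real \<Rightarrow> real \<Rightarrow> real" where
  "xstar \<alpha> T = exp ((gammastar \<alpha> - T) / \<alpha>)"

definition M0 :: "real \<Rightarrow> real" where
  "M0 \<sigma> = 2 * Max {\<sigma>\<^sup>2 / 4,
                    1 + real_of_int (ceiling (9 * pi\<^sup>2 / \<sigma>\<^sup>2)),
                    2 * real_of_int (ceiling ((1 + sqrt (pi / \<sigma>)) ^ 4))}"

definition Upsilon :: "real \<Rightarrow> real \<Rightarrow> real \<Rightarrow> real \<Rightarrow> real set" where
  "Upsilon \<alpha> \<sigma> T h = {x. xstar \<alpha> T \<le> x \<and> x \<le> 1 \<and>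
       (T + \<alpha> * ln x)\<^sup>2 - \<alpha>\<^sup>2 * pi\<^sup>2 > M0 \<sigma> * h}"

end

theory Submission
  imports Defs "HOL-Complex_Analysis.Complex_Analysis"
begin

text \<open>Put \<open>B = T / \<alpha> + ln x\<close>, \<open>c = 4 * pi\<^sup>2 / \<sigma>\<^sup>2\<close> and \<open>u = \<alpha>\<^sup>2 * t\<^sup>2\<close>. Since \<open>fhat\<close> is even and
  constant on a whole number of periods around \<open>0\<close>, its Fourier coefficient with index \<open>\<plusminus> n\<close> is
  \<open>2 * sin (\<alpha> * pi) / pi * exp (- T)\<close> times the real part of the integral of
  \<open>exp (\<alpha> * t) / (1 + exp (t - B)) * exp (2 * pi * \<i> * n * t\<^sup>2 / \<sigma>\<^sup>2)\<close> over \<open>t \<ge> \<sigma>\<close>. The path is moved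
  up to the line \<open>Im t = 2 * pi * K\<close> with \<open>2 * pi * K \<ge> \<sigma>\<close>. The poles \<open>B + (2 * k + 1) * pi * \<i>\<close> in
  between contribute \<open>O (exp ((\<alpha> - c) * B) / n\<^sup>2)\<close>, which is the residue term of the theorem; on the
  vertical edge at \<open>\<sigma>\<close> the Gaussian factor decays, and one integration by parts gives
  \<open>O (exp (\<sigma>\<^sup>2 * \<alpha>\<^sup>2) / n\<^sup>2)\<close>. Uniformity in \<open>\<alpha>\<close> and \<open>\<sigma>\<close> comes from
  \<open>sin (\<alpha> * pi) / pi \<le> min \<alpha> (1 - \<alpha>)\<close>.\<close>

section \<open>The contour integral and its residues\<close>

definition gauss :: "real \<Rightarrow> complex \<Rightarrow> complex" where
  "gauss \<mu> t = exp (\<i> * of_real \<mu> * t\<^sup>2)"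

text \<open>For 0 < \<alpha> < 1 this grows on the real axis like \<open>exp (\<alpha> * t)\<close>
  up to the cutoff \<open>B\<close> and decays like \<open>exp (- (1 - \<alpha>) * t)\<close> beyond
  it, as a Fermi function does.\<close>

definition fermi :: "real \<Rightarrow> real \<Rightarrow> complex \<Rightarrow> complex" where
  "fermi \<alpha> B t = exp (of_real \<alpha> * t) / (1 + exp (t - of_real B))"

text \<open>Since \<open>t\<^sup>2\<close> has imaginary part \<open>2 * Re t * Im t\<close>, the
  kernel has modulus 1 on the real axis and, for \<mu> > 0, decays inside the first quadrant; hence
  the move of the path upwards.\<close>

lemma norm_gauss: "norm (gauss \<mu> t) = exp (- (2 * \<mu> * Re t * Im t))"
  by (simp add: gauss_def norm_exp_eq_Re power2_eq_square algebra_simps)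

lemma one_plus_exp_eq_0_iff:
  fixes w :: complex
  shows "1 + exp w = 0 \<longleftrightarrow> (\<exists>k::int. w = \<i> * (of_int (2 * k + 1) * pi))"
proof -
  have "1 + exp w = 0 \<longleftrightarrow> exp w = exp (\<i> * pi)"
    by (simp add: add_eq_0_iff)
  also have "\<dots> \<longleftrightarrow> (\<exists>k::int. w = \<i> * (of_int (2 * k + 1) * pi))"
    unfolding exp_eq by (simp add: algebra_simps)
  finally show ?thesis .
qed

lemma fermi_pole_iff:
  "1 + exp (t - of_real B) = 0 \<longleftrightarrow> (\<exists>k::int. t = Complex B ((2 * k + 1) * pi))"
  unfolding one_plus_exp_eq_0_iff by (auto simp: complex_eq_iff algebra_simps)

lemma has_field_derivative_fermi:
  assumes "1 + exp (t - of_real B) \<noteq> 0"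
  shows "(fermi \<alpha> B has_field_derivative
           fermi \<alpha> B t * (of_real \<alpha> - exp (t - of_real B) / (1 + exp (t - of_real B)))) (at t)"
  unfolding fermi_def [abs_def]
  by (rule derivative_eq_intros refl assms | simp)+
     (use assms in \<open>simp add: divide_simps power2_eq_square, simp add: algebra_simps\<close>)

lemma has_field_derivative_gauss:
  "(gauss \<mu> has_field_derivative 2 * \<i> * \<mu> * t * gauss \<mu> t) (at t)"
  unfolding gauss_def [abs_def] by (auto intro!: derivative_eq_intros)

lemma holomorphic_fermi_gauss:
  assumes "\<And>t. t \<in> S \<Longrightarrow> 1 + exp (t - of_real B) \<noteq> 0"
  shows "(\<lambda>t. fermi \<alpha> B t * gauss \<mu> t) holomorphic_on S"
  unfolding fermi_def gauss_def using assms by (intro holomorphic_intros) auto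

text \<open>At a zero \<open>z\<close> of the denominator \<open>exp (z - B) = -1\<close>, which is
  also the derivative of the denominator there. The pole is therefore simple and the residue is
  minus the numerator.\<close>

lemma residue_fermi_gauss:
  fixes k :: int and B :: real
  defines "z \<equiv> Complex B ((2 * real_of_int k + 1) * pi)"
  shows "residue (\<lambda>t. fermi \<alpha> B t * gauss \<mu> t) z = - exp (of_real \<alpha> * z) * gauss \<mu> z"
proof (rule residue_simple')
  \<comment> \<open>The poles are spaced by \<open>2 * pi * \<i>\<close>; this open strip of the
    same height is centred at \<open>z\<close> and contains no other pole.\<close>
  define S where "S = {w. 2 * real_of_int k * pi < Im w \<and> Im w < (2 * real_of_int k + 2) * pi}"
  show "open S"
    unfolding S_def by (intro open_Collect_conj open_Collect_less continuous_intros)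
  show "z \<in> S"
    by (simp add: S_def z_def)
  have "t = z" if "t \<in> S" "1 + exp (t - of_real B) = 0" for t
  proof -
    from that(2) obtain l :: int where l: "t = Complex B ((2 * l + 1) * pi)"
      by (auto simp: fermi_pole_iff)
    then have "l = k"
      using that(1) by (simp add: S_def)
    then show ?thesis by (simp add: l z_def)
  qed
  then show "(\<lambda>t. fermi \<alpha> B t * gauss \<mu> t) holomorphic_on S - {z}"
    by (intro holomorphic_fermi_gauss) auto
  have z0: "1 + exp (z - of_real B) = 0"
    unfolding fermi_pole_iff z_def by blast
  then have z1: "exp (z - of_real B) = -1"
    by (simp add: add_eq_0_iff)
  have "((\<lambda>w. 1 + exp (w - of_real B)) has_field_derivative -1) (at z)"
    by (rule derivative_eq_intros refl | simp add: z1)+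
  then have "((\<lambda>w. (1 + exp (w - of_real B)) / (w - z)) \<longlongrightarrow> -1) (at z)"
    by (simp add: has_field_derivative_iff z1)
  from tendsto_inverse [OF this]
  have inv: "((\<lambda>w. (w - z) / (1 + exp (w - of_real B))) \<longlongrightarrow> -1) (at z)"
    by (simp add: inverse_eq_divide)
  have "((\<lambda>w. exp (of_real \<alpha> * w) * gauss \<mu> w) \<longlongrightarrow> exp (of_real \<alpha> * z) * gauss \<mu> z) (at z)"
    unfolding gauss_def by (intro tendsto_intros)
  from tendsto_mult [OF this inv]
  show "((\<lambda>w. fermi \<alpha> B w * gauss \<mu> w * (w - z)) \<longlongrightarrow> - exp (of_real \<alpha> * z) * gauss \<mu> z) (at z)"
    by (simp add: fermi_def mult_ac)
qed

section \<open>Contour integrals over rectangles\<close>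

text \<open>All edges are taken in the direction of increasing coordinate, as the edge estimates use
  them; \<open>rectpath\<close> runs through the top and left edges backwards, whence their minus
  signs.\<close>

lemma contour_integral_rectpath:
  assumes "continuous_on (path_image (rectpath (Complex a c) (Complex b d))) f" "a \<le> b" "c \<le> d"
  shows "contour_integral (rectpath (Complex a c) (Complex b d)) f =
           contour_integral (linepath (Complex a c) (Complex b c)) f +
           contour_integral (linepath (Complex b c) (Complex b d)) f -
           contour_integral (linepath (Complex a d) (Complex b d)) f -
           contour_integral (linepath (Complex a c) (Complex a d)) f"
proof -
  have "f contour_integrable_on linepath (Complex a c) (Complex b c)"
    "f contour_integrable_on linepath (Complex b c) (Complex b d)"
    "f contour_integrable_on linepath (Complex b d) (Complex a d)"
    "f contour_integrable_on linepath (Complex a d) (Complex a c)"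
    using assms by (auto intro!: contour_integrable_continuous_linepath elim!: continuous_on_subset
        simp: path_image_rectpath closed_segment_same_Re closed_segment_same_Im closed_segment_eq_real_ivl split: if_splits)
  moreover have "contour_integral (linepath (Complex b d) (Complex a d)) f =
      - contour_integral (linepath (Complex a d) (Complex b d)) f"
    "contour_integral (linepath (Complex a d) (Complex a c)) f =
      - contour_integral (linepath (Complex a c) (Complex a d)) f"
    using assms by (auto intro!: contour_integral_reverse_linepath elim!: continuous_on_subset
        simp: path_image_rectpath closed_segment_same_Re closed_segment_same_Im closed_segment_eq_real_ivl split: if_splits)
  ultimately show ?thesis
    by (simp add: rectpath_def Let_def)
qed

lemma contour_integral_linepath_same_Im:
  assumes "a < b"
  shows "contour_integral (linepath (Complex a y) (Complex b y)) f =
           integral {a..b} (\<lambda>x. f (Complex x y))"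
proof -
  have "contour_integral (linepath (Complex a y) (Complex b y)) f =
          contour_integral (linepath (of_real a) (of_real b)) (\<lambda>z. f (z + \<i> * y))"
    by (simp add: contour_integral_integral linepath_def Complex_eq algebra_simps scaleR_conv_of_real)
  also have "\<dots> = integral {a..b} (\<lambda>x. f (of_real x + \<i> * y))"
    using assms by (subst contour_integral_linepath_Reals_eq) auto
  finally show ?thesis by (simp add: Complex_eq)
qed

text \<open>The height \<open>2 * pi * K\<close> lies midway between two neighbouring poles, so the
  rectangle encloses exactly those at heights \<open>pi\<close>, \<open>3 * pi\<close>, up to
  \<open>(2 * K - 1) * pi\<close>, each with winding number 1.\<close>

lemma contour_integral_fermi_gauss_rectpath:
  fixes K :: nat and \<alpha> \<mu> \<sigma> B R :: real
  assumes "\<sigma> < B" "B < R" "K \<ge> 1"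
  defines "f \<equiv> \<lambda>t. fermi \<alpha> B t * gauss \<mu> t" and "q \<equiv> 2 * pi * real K"
  shows "contour_integral (rectpath (Complex \<sigma> 0) (Complex R q)) f =
           - (2 * pi * \<i> * (\<Sum>k<K. exp (of_real \<alpha> * Complex B ((2 * real k + 1) * pi)) *
                                gauss \<mu> (Complex B ((2 * real k + 1) * pi))))"
proof -
  \<comment> \<open>The bounding lines pass through the nearest poles below and above the rectangle.
    Being open, the strip contains the \<open>K\<close> enclosed poles and no others.\<close>
  define S where "S = {w. - pi < Im w \<and> Im w < q + pi}"
  define z where "z k = Complex B ((2 * real k + 1) * pi)" for k :: nat
  have inj: "inj_on z {..<K}"
    by (auto simp: inj_on_def z_def)
  have box: "z k \<in> box (Complex \<sigma> 0) (Complex R q)" if "k < K" for k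
  proof -
    have "(2 * real k + 1) * pi < 2 * real K * pi"
      using that by (intro mult_strict_right_mono) auto
    then show ?thesis
      using assms by (simp add: z_def in_box_complex_iff q_def mult_ac)
  qed
  have poles: "t \<in> z ` {..<K}" if "t \<in> S" "1 + exp (t - of_real B) = 0" for t
  proof -
    from that(2) obtain l :: int where l: "t = Complex B ((2 * l + 1) * pi)"
      by (auto simp: fermi_pole_iff)
    \<comment> \<open>Dividing by \<open>pi\<close> turns the strip condition into
      \<open>-1 < 2 * l + 1 < 2 * K + 1\<close>, which for an integer means
      \<open>0 \<le> l < K\<close>.\<close>
    have "(-1) * pi < (2 * real_of_int l + 1) * pi" "(2 * real_of_int l + 1) * pi < (2 * real K + 1) * pi"
      using that(1) by (simp_all add: S_def l q_def algebra_simps)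
    then have "-1 < 2 * real_of_int l + 1" "2 * real_of_int l + 1 < 2 * real K + 1"
      by (simp_all only: mult_less_cancel_right_pos [OF pi_gt_zero])
    then have "0 \<le> l" "l < int K" by linarith+
    then have "t = z (nat l)" "nat l < K"
      by (simp_all add: l z_def)
    then show ?thesis by blast
  qed
  have bS: "cbox (Complex \<sigma> 0) (Complex R q) \<subseteq> S"
    by (auto simp: S_def in_cbox_complex_iff intro: less_le_trans [of _ 0] le_less_trans [of _ q])
  have le: "\<sigma> \<le> R" "0 \<le> q" using assms by (auto simp: q_def)
  have "contour_integral (rectpath (Complex \<sigma> 0) (Complex R q)) f =
    2 * pi * \<i> * (\<Sum>p\<in>z ` {..<K}. winding_number (rectpath (Complex \<sigma> 0) (Complex R q)) p * residue f p)"
  proof (rule Residue_theorem)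
    show "open S"
      unfolding S_def by (intro open_Collect_conj open_Collect_less continuous_intros)
    have "convex S"
      unfolding S_def Collect_conj_eq
      by (intro convex_Int convex_halfspace_Im_gt convex_halfspace_Im_lt)
    then show "connected S" by (rule convex_connected)
    show "f holomorphic_on S - z ` {..<K}"
      unfolding f_def using poles by (intro holomorphic_fermi_gauss) auto
    have "path_image (rectpath (Complex \<sigma> 0) (Complex R q)) \<inter> z ` {..<K} = {}"
      using box path_image_rectpath_inter_box[of "Complex \<sigma> 0" "Complex R q"] le by auto
    then show "path_image (rectpath (Complex \<sigma> 0) (Complex R q)) \<subseteq> S - z ` {..<K}"
      using bS path_image_rectpath_subset_cbox[of "Complex \<sigma> 0" "Complex R q"] le by auto
    show "\<forall>w. w \<notin> S \<longrightarrow> winding_number (rectpath (Complex \<sigma> 0) (Complex R q)) w = 0"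
      using bS le by (auto intro!: winding_number_rectpath_outside)
  qed auto
  also have "\<dots> = 2 * pi * \<i> * (\<Sum>k<K. residue f (z k))"
    by (subst sum.reindex [OF inj]) (simp add: winding_number_rectpath box)
  also have "(\<Sum>k<K. residue f (z k)) = (\<Sum>k<K. - exp (of_real \<alpha> * z k) * gauss \<mu> (z k))"
    using residue_fermi_gauss [of \<alpha> B \<mu> "int k" for k]
    by (intro sum.cong) (simp_all add: f_def z_def)
  finally show ?thesis
    by (simp add: z_def sum_negf)
qed

section \<open>Elementary estimates\<close>

text \<open>A majorant that is given as a derivative is integrated at once, so an estimate along an
  edge reduces to the choice of \<open>G\<close>.\<close>

lemma norm_integral_le_antiderivative:
  fixes f :: "real \<Rightarrow> 'a::euclidean_space"
  assumes "a \<le> b" "continuous_on {a..b} f"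
    and "\<And>x. x \<in> {a..b} \<Longrightarrow> (G has_real_derivative G' x) (at x within {a..b})"
    and "\<And>x. x \<in> {a..b} \<Longrightarrow> norm (f x) \<le> G' x"
  shows "norm (integral {a..b} f) \<le> G b - G a"
proof -
  have G: "(G' has_integral (G b - G a)) {a..b}"
    using assms by (intro fundamental_theorem_of_calculus)
      (auto simp: has_real_derivative_iff_has_vector_derivative)
  have "norm (integral {a..b} f) \<le> integral {a..b} G'"
    using assms G by (intro integral_norm_bound_integral has_integral_integrable [OF G]
        integrable_continuous_real) auto
  then show ?thesis
    using G by (simp add: integral_unique)
qed

lemma exp_bound_nat:
  fixes n :: nat assumes "n \<ge> 1"
  shows "real n \<le> exp (real n - 1)"
  using exp_ge_add_one_self[of "real n - 1"] by simp

text \<open>Squaring \<open>n \<le> exp (n - 1)\<close> suffices. Surplus Gaussian decay is traded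
  here for the summable factor \<open>1 / n^2\<close>; the shift by 1 makes the condition for
  \<open>n = 1\<close> merely \<open>y \<ge> 0\<close>.\<close>

lemma exp_minus_bound_nat:
  fixes n :: nat and y :: real
  assumes "n \<ge> 1" "y \<ge> 2 * (real n - 1)"
  shows "exp (- y) \<le> 1 / real n ^ 2"
proof -
  have "exp (- y) \<le> exp (-(2 * (real n - 1)))"
    using assms by simp
  also have "\<dots> = inverse (exp (real n - 1)) ^ 2"
    by (simp only: exp_minus exp_double power_inverse)
  also have "\<dots> \<le> inverse (real n) ^ 2"
    using exp_bound_nat[OF assms(1)] assms(1) by (intro power_mono le_imp_inverse_le) auto
  finally show ?thesis by (simp add: field_simps)
qed

lemma exp_double_le_exp_square:
  fixes z :: real
  shows "exp (2 * z) \<le> 3 * exp (z\<^sup>2)"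
proof -
  have "2 * z \<le> 1 + z\<^sup>2"
    using zero_le_power2[of "z - 1"] by (simp add: power2_eq_square algebra_simps)
  then have "exp (2 * z) \<le> exp 1 * exp (z\<^sup>2)"
    by (simp flip: exp_add)
  also have "\<dots> \<le> 3 * exp (z\<^sup>2)"
    by (intro mult_right_mono exp_le) auto
  finally show ?thesis .
qed

text \<open>In the application \<open>z = \<alpha> * \<sigma>\<close>, so
  \<open>z\<^sup>2 = h\<close>: this is how the left edge produces the factor \<open>exp h\<close>
  of the theorem. The polynomial costs one more \<open>exp z\<close>, and \<open>exp (2 * z)\<close>
  is dominated by completing the square.\<close>

lemma left_edge_elementary_bound:
  fixes z :: real
  assumes "z \<ge> 0"
  shows "z * (z + 4) * exp z \<le> 18 * exp (z\<^sup>2)"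
proof -
  have "1 + z + z\<^sup>2 / 2 \<le> exp z"
    by (rule exp_lower_Taylor_quadratic [OF assms])
  moreover have "z * (z + 4) = z\<^sup>2 + 4 * z"
    by (simp add: power2_eq_square algebra_simps)
  ultimately have "z * (z + 4) \<le> 6 * exp z"
    using assms zero_le_power2[of z] by linarith
  then have "z * (z + 4) * exp z \<le> 6 * exp z * exp z"
    by (rule mult_right_mono) (rule exp_ge_zero)
  also have "\<dots> = 6 * exp (2 * z)"
    by (simp only: mult_2 exp_add mult.assoc)
  finally show ?thesis
    using exp_double_le_exp_square[of z] by linarith
qed

text \<open>The logistic factor limits the integral to about \<open>[0, B]\<close>; the prefactor \<open>A\<close> (in the
  application \<open>sin (\<alpha> * pi) / pi\<close>) compensates the length of this interval and the slow decay
  beyond it.\<close>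

lemma logistic_exp_integral_bound:
  fixes A \<alpha> c B \<sigma> R :: real
  assumes "0 < \<alpha>" "\<alpha> < 1" "0 \<le> A" "A \<le> \<alpha>" "A \<le> 1 - \<alpha>" "0 < c" "0 \<le> \<sigma>" "\<sigma> \<le> B" "B \<le> R"
  shows "A * integral {\<sigma>..R} (\<lambda>p. exp ((\<alpha> - 2 * c) * p) / (1 + exp (p - B)))
           \<le> 3 + 4 * exp ((\<alpha> - c) * B)"
proof -
  define m where "m = \<alpha> - 2 * c"
  define f where "f = (\<lambda>p. exp (m * p) / (1 + exp (p - B)))"
  have pos: "1 + exp (p - B) > 0" for p
    by (simp add: add_pos_pos)
  have cont: "continuous_on S f" for S
    unfolding f_def using pos by (intro continuous_intros) (metis less_irrefl)
  have f0: "0 \<le> f p" for p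
    using pos[of p] by (simp add: f_def)
  have fle: "f p \<le> exp (m * p)" for p
    unfolding f_def using pos[of p] by (simp add: divide_le_eq mult_ge1_I)
  \<comment> \<open>Dropping the 1 in the denominator instead of the exponential gives the bound
    that is useful to the right of \<open>B\<close>.\<close>
  have fle': "f p \<le> exp (m * p - (p - B))" for p
  proof -
    have "f p \<le> exp (m * p) / exp (p - B)"
      unfolding f_def by (intro divide_left_mono) (auto simp: add_pos_pos)
    then show ?thesis by (simp add: exp_diff)
  qed
  \<comment> \<open>Integration brings in \<open>1 / m\<close> or \<open>1 / c\<close>, which
    \<open>A \<le> \<alpha>\<close> has to absorb. If \<alpha> \<ge> 3c, then \<open>m\<close> is
    positive and \<alpha> \<le> 3m; otherwise \<alpha> < 3c. The threshold 3 serves both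
    cases.\<close>
  have "A * integral {\<sigma>..B} f \<le> 3 + 3 * exp ((\<alpha> - c) * B)"
  proof (cases "\<alpha> \<ge> 3 * c")
    case True
    then have m: "m > 0" "\<alpha> \<le> 3 * m" using assms by (auto simp: m_def)
    have "norm (integral {\<sigma>..B} f) \<le> exp (m * B) / m - exp (m * \<sigma>) / m"
      by (rule norm_integral_le_antiderivative [where G' = "\<lambda>p. exp (m * p)"])
        (use m assms cont f0 fle in \<open>auto intro!: derivative_eq_intros\<close>)
    also have "\<dots> \<le> exp (m * B) / m"
      using m by simp
    also have "\<dots> \<le> exp ((\<alpha> - c) * B) / m"
      using m assms by (intro divide_right_mono) (auto simp: m_def intro!: mult_right_mono)
    finally have "A * integral {\<sigma>..B} f \<le> A * (exp ((\<alpha> - c) * B) / m)"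
      using assms by (intro mult_left_mono) auto
    also have "\<dots> \<le> (3 * m) * (exp ((\<alpha> - c) * B) / m)"
      using assms m by (intro mult_right_mono) auto
    finally show ?thesis using m by simp
  next
    case False
    \<comment> \<open>On \<open>[0, B]\<close> the monotone function
      \<open>exp ((\<alpha> - c) * p)\<close> is at most the larger of its end values; their sum
      \<open>E\<close> covers both signs of \<alpha> - c.\<close>
    define E where "E = 1 + exp ((\<alpha> - c) * B)"
    have E: "f p \<le> E * exp (- c * p)" if "p \<in> {\<sigma>..B}" for p
    proof -
      have p: "0 \<le> p" "p \<le> B" using that assms by auto
      have "exp ((\<alpha> - c) * p) \<le> E"
      proof (cases "\<alpha> \<ge> c")
        case True
        then have "exp ((\<alpha> - c) * p) \<le> exp ((\<alpha> - c) * B)"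
          using p by (auto intro!: mult_left_mono)
        then show ?thesis unfolding E_def by linarith
      next
        case False
        then have "exp ((\<alpha> - c) * p) \<le> 1"
          using p by (auto intro!: mult_nonpos_nonneg)
        then show ?thesis by (simp add: E_def add_increasing2)
      qed
      then have "exp ((\<alpha> - c) * p) * exp (- c * p) \<le> E * exp (- c * p)"
        by (intro mult_right_mono) auto
      moreover have "exp ((\<alpha> - c) * p) * exp (- c * p) = exp (m * p)"
        by (simp add: m_def algebra_simps flip: exp_add)
      ultimately show ?thesis using fle[of p] by linarith
    qed
    have "norm (integral {\<sigma>..B} f) \<le> (- E * exp (- c * B) / c) - (- E * exp (- c * \<sigma>) / c)"
      by (rule norm_integral_le_antiderivative [where G' = "\<lambda>p. E * exp (- c * p)"])
        (use assms cont f0 E in \<open>auto intro!: derivative_eq_intros\<close>)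
    also have "\<dots> \<le> E / c"
    proof -
      have "E * exp (- c * \<sigma>) \<le> E * 1"
        using assms by (intro mult_left_mono) (auto simp: E_def add_nonneg_nonneg)
      moreover have "0 \<le> E * exp (- c * B)" by (simp add: E_def)
      ultimately have "E * exp (- c * \<sigma>) - E * exp (- c * B) \<le> E" by linarith
      from divide_right_mono [OF this, of c] show ?thesis
        using assms by (simp add: diff_divide_distrib)
    qed
    finally have "A * integral {\<sigma>..B} f \<le> A * (E / c)"
      using assms by (intro mult_left_mono) auto
    also have "\<dots> \<le> (3 * c) * (E / c)"
      using assms False by (intro mult_right_mono) (auto simp: E_def)
    finally show ?thesis using assms by (simp add: E_def)
  qed
  moreover have "A * integral {B..R} f \<le> exp ((\<alpha> - c) * B)"
  proof -
    \<comment> \<open>Beyond \<open>B\<close> the decay rate is \<open>d\<close>, and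
      \<open>A \<le> 1 - \<alpha> \<le> d\<close> absorbs the factor \<open>1 / d\<close>, uniformly
      as \<alpha> tends to 1.\<close>
    define d where "d = 1 - m"
    have d: "d \<ge> 1 - \<alpha>" "d > 0" using assms by (auto simp: d_def m_def)
    have fle'': "f p \<le> exp (B - d * p)" for p
      using fle'[of p] by (simp add: d_def algebra_simps)
    have "norm (integral {B..R} f) \<le> (- exp (B - d * R) / d) - (- exp (B - d * B) / d)"
      by (rule norm_integral_le_antiderivative [where G' = "\<lambda>p. exp (B - d * p)"])
        (use assms d cont f0 fle'' in \<open>auto intro!: derivative_eq_intros\<close>)
    also have "\<dots> \<le> exp (B - d * B) / d"
      using d by simp
    also have "\<dots> \<le> exp ((\<alpha> - c) * B) / d"
      using assms d by (intro divide_right_mono) (auto simp: d_def m_def algebra_simps)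
    finally have "A * integral {B..R} f \<le> A * (exp ((\<alpha> - c) * B) / d)"
      using assms by (intro mult_left_mono) auto
    also have "\<dots> \<le> d * (exp ((\<alpha> - c) * B) / d)"
      using assms d by (intro mult_right_mono) auto
    finally show ?thesis using d by simp
  qed
  moreover have "integral {\<sigma>..R} f = integral {\<sigma>..B} f + integral {B..R} f"
    using assms cont by (intro Henstock_Kurzweil_Integration.integral_combine [symmetric] integrable_continuous_real) auto
  ultimately show ?thesis
    by (simp add: f_def m_def distrib_left)
qed

section \<open>The edges of the rectangle\<close>

text \<open>As \<open>exp (- 1) \<le> 1 / 2\<close>, at least half of the 1 survives. This controls
  the denominator on the left edge, where \<open>\<sigma> + 1 \<le> B\<close>.\<close>

lemma norm_one_plus_exp_ge:
  fixes w :: complex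
  assumes "Re w \<le> -1"
  shows "norm (1 + exp w) \<ge> 1 / 2"
proof -
  have "1 \<le> norm (1 + exp w) + norm (exp w)"
    using norm_triangle_ineq4[of "1 + exp w" "exp w"] by simp
  moreover have "norm (exp w) \<le> exp (- 1)"
    using assms by simp
  moreover have "exp (- 1 :: real) \<le> 1 / 2"
    using exp_ge_add_one_self[of 1] by (simp add: exp_minus field_simps)
  ultimately show ?thesis by linarith
qed

text \<open>Integration by parts: the boundary term at \<open>\<sigma>\<close> is purely imaginary, which provides the
  decay \<open>1 / n\<^sup>2\<close> of the real part.\<close>

lemma fermi_gauss_left_edge:
  fixes n :: nat and \<alpha> \<sigma> B A q :: real
  assumes \<alpha>: "0 < \<alpha>" "0 \<le> A" "A \<le> \<alpha>" and \<sigma>: "0 < \<sigma>" "\<sigma> \<le> q"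
    and B: "2 * \<sigma> \<le> B" "\<sigma> + 1 \<le> B" and n: "1 \<le> n"
  defines "\<mu> \<equiv> 2 * pi * real n / \<sigma>\<^sup>2"
  shows "A * \<bar>Re (contour_integral (linepath (Complex \<sigma> 0) (Complex \<sigma> q))
               (\<lambda>t. fermi \<alpha> B t * gauss \<mu> t))\<bar> \<le> 18 * exp ((\<alpha> * \<sigma>)\<^sup>2) / real n ^ 2"
proof -
  define F where "F = fermi \<alpha> B"
  define L where "L t = of_real \<alpha> - exp (t - of_real B) / (1 + exp (t - of_real B))" for t :: complex
  \<comment> \<open>Since \<open>gauss\<close> has derivative
    \<open>2 * \<i> * \<mu> * t * gauss\<close>, dividing \<open>F\<close> by this factor makes
    \<open>W * gauss\<close> a primitive of \<open>F * gauss\<close> up to the remainder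
    \<open>D * gauss\<close>, where \<open>D\<close> is the derivative of \<open>W\<close>.\<close>
  define W where "W t = F t / (2 * \<i> * \<mu> * t)" for t :: complex
  define D where "D t = (F t * L t / t - F t / t\<^sup>2) / (2 * \<i> * \<mu>)" for t :: complex
  \<comment> \<open>\<open>M\<close> bounds \<open>D\<close> on the line
    \<open>Re t = \<sigma>\<close>. It is already of order \<open>1 / \<mu>\<close>, and integrating
    the Gaussian factor supplies the second power.\<close>
  define M where "M = 2 * exp (\<alpha> * \<sigma>) * ((\<alpha> + 2 * exp (\<sigma> - B)) / \<sigma> + 1 / \<sigma>\<^sup>2) / (2 * \<mu>)"
  define \<gamma> where "\<gamma> = linepath (Complex \<sigma> 0) (Complex \<sigma> q)"
  have q: "q > 0" using \<sigma> by linarith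
  have \<mu>: "\<mu> > 0" using n \<sigma> by (simp add: \<mu>_def)
  have seg: "path_image \<gamma> = {t. Re t = \<sigma> \<and> Im t \<in> {0..q}}"
    using q by (auto simp: \<gamma>_def closed_segment_same_Re closed_segment_eq_real_ivl)
  have half: "norm (1 + exp (t - of_real B)) \<ge> 1 / 2" if "Re t = \<sigma>" for t
    using that B by (intro norm_one_plus_exp_ge) simp
  have nz: "1 + exp (t - of_real B) \<noteq> 0" "t \<noteq> 0" if "Re t = \<sigma>" for t
    using half[OF that] that \<sigma> by auto
  have F': "(F has_field_derivative F t * L t) (at t)" if "Re t = \<sigma>" for t
    unfolding F_def L_def using nz(1)[OF that] by (rule has_field_derivative_fermi)
  have W': "(W has_field_derivative D t) (at t)" if "Re t = \<sigma>" for t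
    unfolding W_def [abs_def] D_def using nz[OF that] \<mu>
    by (auto intro!: derivative_eq_intros F'[OF that] simp: field_simps power2_eq_square)
  have WG: "((\<lambda>t. W t * gauss \<mu> t) has_field_derivative (D t * gauss \<mu> t + F t * gauss \<mu> t))
      (at t within S)" if "Re t = \<sigma>" for t S
    by (rule DERIV_subset [OF _ subset_UNIV]; (rule derivative_eq_intros W'[OF that] has_field_derivative_gauss)+)
      (use nz(2)[OF that] \<mu> in \<open>simp add: W_def\<close>)
  have "((\<lambda>t. D t * gauss \<mu> t + F t * gauss \<mu> t) has_contour_integral
      (W (pathfinish \<gamma>) * gauss \<mu> (pathfinish \<gamma>) - W (pathstart \<gamma>) * gauss \<mu> (pathstart \<gamma>))) \<gamma>"
    by (rule contour_integral_primitive [where S = "path_image \<gamma>"]) (use WG seg in \<open>auto simp: \<gamma>_def\<close>)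
  then have sum: "contour_integral \<gamma> (\<lambda>t. D t * gauss \<mu> t + F t * gauss \<mu> t) =
      W (Complex \<sigma> q) * gauss \<mu> (Complex \<sigma> q) - W (of_real \<sigma>) * gauss \<mu> (of_real \<sigma>)"
    by (simp add: contour_integral_unique \<gamma>_def complex_of_real_def)
  have contF: "continuous_on {t. Re t = \<sigma>} F"
    using F' by (intro DERIV_continuous_on) (auto intro: has_field_derivative_at_within)
  have contG: "continuous_on S (gauss \<mu>)" for S
    unfolding gauss_def [abs_def] by (intro continuous_intros)
  have contD: "continuous_on {t. Re t = \<sigma>} D"
    unfolding D_def [abs_def] L_def using nz contF \<mu> by (intro continuous_intros) auto
  have contDG: "continuous_on {t. Re t = \<sigma>} (\<lambda>t. D t * gauss \<mu> t)"
    by (intro continuous_intros contD contG)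
  have "contour_integral \<gamma> (\<lambda>t. D t * gauss \<mu> t + F t * gauss \<mu> t) =
      contour_integral \<gamma> (\<lambda>t. D t * gauss \<mu> t) + contour_integral \<gamma> (\<lambda>t. F t * gauss \<mu> t)"
    unfolding \<gamma>_def
    by (intro contour_integral_add contour_integrable_continuous_linepath continuous_on_mult contG
        continuous_on_subset [OF contF] continuous_on_subset [OF contD]) (use seg in \<open>auto simp: \<gamma>_def\<close>)
  then have eq: "contour_integral \<gamma> (\<lambda>t. F t * gauss \<mu> t) =
      W (Complex \<sigma> q) * gauss \<mu> (Complex \<sigma> q) - W (of_real \<sigma>) * gauss \<mu> (of_real \<sigma>)
      - contour_integral \<gamma> (\<lambda>t. D t * gauss \<mu> t)"
    using sum by (simp add: algebra_simps)
  \<comment> \<open>At \<open>\<sigma>\<close> the phase is a multiple of \<open>2 * pi\<close>, so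
    \<open>gauss\<close> equals 1 there; as \<open>F\<close> is real at \<open>\<sigma>\<close>,
    dividing by \<open>2 * \<i> * \<mu> * \<sigma>\<close> makes the boundary term
    imaginary.\<close>
  have "\<mu> * \<sigma>\<^sup>2 = 2 * real_of_int (int n) * pi"
    using \<sigma> by (simp add: \<mu>_def)
  then have "gauss \<mu> (of_real \<sigma>) = 1"
    unfolding gauss_def by (subst exp_eq_1) (auto intro!: exI [of _ "int n"] simp flip: of_real_power)
  moreover have "F (of_real \<sigma>) = of_real (exp (\<alpha> * \<sigma>) / (1 + exp (\<sigma> - B)))"
    by (simp add: F_def fermi_def flip: exp_of_real)
  then have "W (of_real \<sigma>) = - \<i> * of_real (exp (\<alpha> * \<sigma>) / (1 + exp (\<sigma> - B)) / (2 * \<mu> * \<sigma>))"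
    using \<mu> \<sigma> unfolding W_def by (simp only: of_real_divide) (simp add: divide_simps)
  ultimately have Re0: "Re (W (of_real \<sigma>) * gauss \<mu> (of_real \<sigma>)) = 0"
    by simp

  have normF: "norm (F t) \<le> 2 * exp (\<alpha> * \<sigma>)" if "Re t = \<sigma>" for t
  proof -
    have "norm (F t) = exp (\<alpha> * \<sigma>) / norm (1 + exp (t - of_real B))"
      using that by (simp add: F_def fermi_def norm_divide)
    also have "\<dots> \<le> exp (\<alpha> * \<sigma>) / (1 / 2)"
      using half[OF that] by (intro divide_left_mono) auto
    finally show ?thesis by simp
  qed
  have normL: "norm (L t) \<le> \<alpha> + 2 * exp (\<sigma> - B)" if "Re t = \<sigma>" for t
  proof -
    have "norm (L t) \<le> \<alpha> + exp (\<sigma> - B) / norm (1 + exp (t - of_real B))"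
      unfolding L_def using that \<alpha> by (intro norm_triangle_le_diff) (simp add: norm_divide)
    also have "\<dots> \<le> \<alpha> + exp (\<sigma> - B) / (1 / 2)"
      using half[OF that] by (intro add_left_mono divide_left_mono) auto
    finally show ?thesis by simp
  qed
  have normt: "\<sigma> \<le> norm t" if "Re t = \<sigma>" for t
    using complex_Re_le_cmod[of t] that by simp
  have normD: "norm (D t) \<le> M" if "Re t = \<sigma>" for t
  proof -
    have "norm (F t * L t / t - F t / t\<^sup>2) \<le> norm (F t * L t / t) + norm (F t / t\<^sup>2)"
      by (rule norm_triangle_ineq4)
    also have "\<dots> \<le> 2 * exp (\<alpha> * \<sigma>) * (\<alpha> + 2 * exp (\<sigma> - B)) / \<sigma> + 2 * exp (\<alpha> * \<sigma>) / \<sigma>\<^sup>2"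
      unfolding norm_divide norm_mult norm_power
      using normF[OF that] normL[OF that] normt[OF that] \<sigma> \<alpha>
      by (intro add_mono frac_le mult_mono power_mono) (auto simp: add_nonneg_nonneg)
    also have "\<dots> = M * (2 * \<mu>)"
      using \<mu> by (simp add: M_def field_simps)
    finally show ?thesis
      using \<mu> by (simp add: D_def norm_divide norm_mult divide_le_eq)
  qed
  have "norm (contour_integral \<gamma> (\<lambda>t. D t * gauss \<mu> t)) =
      norm (integral {0..q} (\<lambda>v. D (Complex \<sigma> v) * gauss \<mu> (Complex \<sigma> v)))"
    unfolding \<gamma>_def by (subst contour_integral_linepath_same_Re [where c = \<sigma> and a = 0 and b = q])
      (use q in \<open>auto simp: norm_mult\<close>)
  also have "\<dots> \<le> (- M / (2 * \<mu> * \<sigma>) * exp (- (2 * \<mu> * \<sigma> * q))) - (- M / (2 * \<mu> * \<sigma>) * exp (- (2 * \<mu> * \<sigma> * 0)))"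
  proof (rule norm_integral_le_antiderivative [where G' = "\<lambda>v. M * exp (- (2 * \<mu> * \<sigma> * v))"])
    show "continuous_on {0..q} (\<lambda>v. D (Complex \<sigma> v) * gauss \<mu> (Complex \<sigma> v))"
      by (rule continuous_on_compose2 [OF contDG]) (auto simp: Complex_eq intro!: continuous_intros)
    show "norm (D (Complex \<sigma> v) * gauss \<mu> (Complex \<sigma> v)) \<le> M * exp (- (2 * \<mu> * \<sigma> * v))" for v
      using normD[of "Complex \<sigma> v"] by (simp add: norm_mult norm_gauss)
  qed (use q \<mu> \<sigma> in \<open>auto intro!: derivative_eq_intros\<close>)
  also have "\<dots> \<le> M / (2 * \<mu> * \<sigma>)"
  proof -
    have "M \<ge> 0"
      using order_trans [OF norm_ge_zero normD [of "of_real \<sigma>"]] by simp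
    then show ?thesis using \<mu> \<sigma> by simp
  qed
  finally have I: "norm (contour_integral \<gamma> (\<lambda>t. D t * gauss \<mu> t)) \<le> M / (2 * \<mu> * \<sigma>)" .
  have "norm (W (Complex \<sigma> q) * gauss \<mu> (Complex \<sigma> q)) \<le>
      2 * exp (\<alpha> * \<sigma>) / (2 * \<mu> * \<sigma>) * exp (- (2 * \<mu> * \<sigma> * q))"
    unfolding W_def norm_mult norm_divide norm_gauss
    using normF[of "Complex \<sigma> q"] normt[of "Complex \<sigma> q"] \<mu> \<sigma> by (intro mult_mono frac_le) auto
  with I have "\<bar>Re (contour_integral \<gamma> (\<lambda>t. F t * gauss \<mu> t))\<bar> \<le>
      2 * exp (\<alpha> * \<sigma>) / (2 * \<mu> * \<sigma>) * exp (- (2 * \<mu> * \<sigma> * q)) + M / (2 * \<mu> * \<sigma>)"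
    unfolding eq minus_complex.sel Re0
    using abs_Re_le_cmod[of "W (Complex \<sigma> q) * gauss \<mu> (Complex \<sigma> q)"]
      abs_Re_le_cmod[of "contour_integral \<gamma> (\<lambda>t. D t * gauss \<mu> t)"] by linarith
  also have "\<dots> \<le> \<sigma> * (\<alpha> * \<sigma> + 4) * exp (\<alpha> * \<sigma>) / real n ^ 2"
  proof -
    \<comment> \<open>The assumption \<open>2 * \<sigma> \<le> B\<close> enters here, through
      \<open>exp (\<sigma> - B) \<le> exp (- \<sigma>)\<close>.\<close>
    have e2: "\<sigma> * exp (\<sigma> - B) \<le> 1"
    proof -
      have "\<sigma> \<le> exp \<sigma>"
        using exp_ge_add_one_self[of \<sigma>] by linarith
      then have "\<sigma> * exp (\<sigma> - B) \<le> exp \<sigma> * exp (- \<sigma>)"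
        using \<sigma> B by (intro mult_mono) auto
      then show ?thesis by (simp add: exp_minus)
    qed
    have pi1: "1 \<le> pi" using pi_gt3 by simp
    have n2: "real n > 0" using n by simp
    have "2 * real n \<le> 2 * \<mu> * \<sigma> * q"
    proof -
      have "2 * real n * \<sigma> \<le> 2 * real n * q" using \<sigma> by (intro mult_left_mono) auto
      also have "\<dots> = 2 * real n * q * 1" by simp
      also have "\<dots> \<le> 2 * real n * q * (2 * pi)" using pi1 q by (intro mult_left_mono) auto
      finally show ?thesis using \<sigma> by (simp add: \<mu>_def field_simps power2_eq_square)
    qed
    then have ex: "exp (- (2 * \<mu> * \<sigma> * q)) \<le> 1 / real n ^ 2"
      using n by (intro exp_minus_bound_nat) auto
    have "2 * exp (\<alpha> * \<sigma>) / (2 * \<mu> * \<sigma>) = \<sigma> * exp (\<alpha> * \<sigma>) / (2 * pi * real n)"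
      using \<sigma> n2 by (simp add: \<mu>_def field_simps power2_eq_square)
    also have "\<dots> \<le> \<sigma> * exp (\<alpha> * \<sigma>) / 1"
    proof (intro divide_left_mono)
      have "1 * 1 \<le> (2 * pi) * real n" using pi1 n by (intro mult_mono) auto
      then show "1 \<le> 2 * pi * real n" by simp
    qed (use \<sigma> n2 in auto)
    finally have 1: "2 * exp (\<alpha> * \<sigma>) / (2 * \<mu> * \<sigma>) * exp (- (2 * \<mu> * \<sigma> * q)) \<le>
        \<sigma> * exp (\<alpha> * \<sigma>) * (1 / real n ^ 2)"
      using ex \<sigma> by (intro mult_mono) auto
    have "M / (2 * \<mu> * \<sigma>) = exp (\<alpha> * \<sigma>) * \<sigma> * (\<alpha> * \<sigma> + 2 * (\<sigma> * exp (\<sigma> - B)) + 1) / (8 * pi\<^sup>2 * real n ^ 2)"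
      using \<sigma> n2 unfolding M_def \<mu>_def
      by (simp add: divide_simps power2_eq_square) (simp add: algebra_simps)
    also have "\<dots> \<le> exp (\<alpha> * \<sigma>) * \<sigma> * (\<alpha> * \<sigma> + 3) / (1 * real n ^ 2)"
    proof (intro frac_le mult_left_mono mult_right_mono)
      have "1 * 1\<^sup>2 \<le> 8 * pi\<^sup>2" using pi1 by (intro mult_mono power_mono) auto
      then show "1 \<le> 8 * pi\<^sup>2" by simp
    qed (use e2 \<sigma> \<alpha> n2 in auto)
    finally have 2: "M / (2 * \<mu> * \<sigma>) \<le> exp (\<alpha> * \<sigma>) * \<sigma> * (\<alpha> * \<sigma> + 3) / real n ^ 2"
      by simp
    from add_mono[OF 1 2] show ?thesis
      by (simp add: algebra_simps add_divide_distrib)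
  qed
  \<comment> \<open>\<open>A \<le> \<alpha>\<close> turns the lone factor \<open>\<sigma>\<close>
    into \<open>\<alpha> * \<sigma>\<close>, so that the bound depends on this product only.\<close>
  finally have "A * \<bar>Re (contour_integral \<gamma> (\<lambda>t. F t * gauss \<mu> t))\<bar> \<le>
      \<alpha> * (\<sigma> * (\<alpha> * \<sigma> + 4) * exp (\<alpha> * \<sigma>) / real n ^ 2)"
    using \<alpha> by (intro mult_mono) auto
  also have "\<dots> \<le> 18 * exp ((\<alpha> * \<sigma>)\<^sup>2) / real n ^ 2"
    using divide_right_mono [OF left_edge_elementary_bound[of "\<alpha> * \<sigma>"], of "real n ^ 2"] \<alpha> \<sigma>
    by (simp add: mult_ac)
  finally show ?thesis
    by (simp add: F_def \<gamma>_def)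
qed

lemma exp_double_pi_i_nat: "exp (\<i> * (2 * of_real pi * of_nat K)) = 1"
  by (subst exp_eq_1) (auto intro!: exI [of _ "int K"])

text \<open>On \<open>Im t = 2 * pi * K\<close> the value \<open>exp (t - B)\<close> is real and
  positive, so the denominator is that of the real axis. Of the Gaussian factor
  \<open>exp (- (2 * c * p * K * n))\<close>, the share \<open>exp (- (2 * c * p))\<close> enters
  the logistic integral and the rest yields \<open>1 / n^2\<close>.\<close>

lemma fermi_gauss_top_edge:
  fixes n K :: nat and \<alpha> \<sigma> B A R :: real
  assumes \<alpha>: "0 < \<alpha>" "\<alpha> < 1" "0 \<le> A" "A \<le> \<alpha>" "A \<le> 1 - \<alpha>" and \<sigma>: "0 < \<sigma>" "\<sigma> \<le> 2 * pi * real K" "1 \<le> K"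
    and B: "\<sigma> \<le> B" "B < R" and n: "1 \<le> n"
  defines "\<mu> \<equiv> 2 * pi * real n / \<sigma>\<^sup>2" and "q \<equiv> 2 * pi * real K" and "c \<equiv> 4 * pi\<^sup>2 / \<sigma>\<^sup>2"
  shows "A * norm (contour_integral (linepath (Complex \<sigma> q) (Complex R q))
               (\<lambda>t. fermi \<alpha> B t * gauss \<mu> t)) \<le> (3 + 4 * exp ((\<alpha> - c) * B)) / real n ^ 2"
proof -
  define f where "f = (\<lambda>p. exp ((\<alpha> - 2 * c) * p) / (1 + exp (p - B)))"
  have pos: "1 + exp (p - B) > 0" for p
    by (simp add: add_pos_pos)
  have c: "c > 0" using \<sigma> by (simp add: c_def)
  have E: "exp (Complex p q - of_real B) = of_real (exp (p - B))" for p
  proof -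
    have "Complex p q - of_real B = of_real (p - B) + \<i> * (2 * of_real pi * of_nat K)"
      by (simp add: complex_eq_iff q_def)
    then show ?thesis
      by (simp only: exp_add exp_double_pi_i_nat exp_of_real mult_1_right)
  qed
  have ex: "exp (- (2 * \<mu> * p * q)) \<le> 1 / real n ^ 2 * exp (- (2 * c * p))" if "\<sigma> \<le> p" for p
  proof -
    have p: "p > 0" using that \<sigma> by linarith
    have K: "1 \<le> real K" using \<sigma> by simp
    have n1: "0 \<le> real n - 1" using n by simp
    have "2 * \<mu> * p * q = 2 * c * p * real K * real n"
      by (simp add: \<mu>_def q_def c_def power2_eq_square)
    also have "\<dots> = 2 * c * p * real K + 2 * c * p * real K * (real n - 1)"
      by (simp add: algebra_simps)
    \<comment> \<open>The splitting needs \<open>c * p * K \<ge> 1\<close>, which follows from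
      \<open>p \<ge> \<sigma>\<close> and \<open>2 * pi * K \<ge> \<sigma>\<close>; this is one
      reason for the height of the rectangle.\<close>
    also have "\<dots> \<ge> 2 * c * p * 1 + 2 * (real n - 1)"
    proof (intro add_mono mult_left_mono)
      have "1 * \<sigma> \<le> (2 * pi) * (2 * pi * real K)"
        using pi_gt3 \<sigma> by (intro mult_mono) auto
      then have "\<sigma> * \<sigma> \<le> 4 * pi\<^sup>2 * real K * \<sigma>"
        using \<sigma> by (intro mult_right_mono) (auto simp: power2_eq_square)
      also have "\<dots> \<le> 4 * pi\<^sup>2 * real K * p"
        using that by (intro mult_left_mono) auto
      finally have "1 \<le> c * p * real K"
        using \<sigma> by (simp add: c_def field_simps power2_eq_square)
      then show "2 * (real n - 1) \<le> 2 * c * p * real K * (real n - 1)"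
        using mult_right_mono[of 2 "2 * c * p * real K" "real n - 1"] n1 by simp
    qed (use K c p in auto)
    finally have "exp (- (2 * \<mu> * p * q)) \<le> exp (- (2 * c * p) + - (2 * (real n - 1)))"
      by simp
    also have "\<dots> = exp (- (2 * c * p)) * exp (- (2 * (real n - 1)))"
      by (rule exp_add)
    also have "\<dots> \<le> exp (- (2 * c * p)) * (1 / real n ^ 2)"
      using n by (intro mult_left_mono exp_minus_bound_nat) auto
    finally show ?thesis by (simp add: mult_ac)
  qed
  have contf: "continuous_on S f" for S
    unfolding f_def using pos by (intro continuous_intros) (metis less_irrefl)
  have "norm (contour_integral (linepath (Complex \<sigma> q) (Complex R q)) (\<lambda>t. fermi \<alpha> B t * gauss \<mu> t)) =
      norm (integral {\<sigma>..R} (\<lambda>p. fermi \<alpha> B (Complex p q) * gauss \<mu> (Complex p q)))"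
    using B by (subst contour_integral_linepath_same_Im) auto
  also have "\<dots> \<le> integral {\<sigma>..R} (\<lambda>p. 1 / real n ^ 2 * f p)"
  proof (rule Henstock_Kurzweil_Integration.integral_norm_bound_integral)
    have "1 + exp (Complex p q - of_real B) \<noteq> 0" for p
      unfolding E using pos[of p] by (metis of_real_1 of_real_add of_real_eq_0_iff less_irrefl)
    then show "(\<lambda>p. fermi \<alpha> B (Complex p q) * gauss \<mu> (Complex p q)) integrable_on {\<sigma>..R}"
      unfolding fermi_def gauss_def Complex_eq
      by (intro integrable_continuous_real continuous_intros) auto
    show "(\<lambda>p. 1 / real n ^ 2 * f p) integrable_on {\<sigma>..R}"
      by (intro integrable_continuous_real continuous_intros contf)
    show "norm (fermi \<alpha> B (Complex p q) * gauss \<mu> (Complex p q)) \<le> 1 / real n ^ 2 * f p"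
      if "p \<in> {\<sigma>..R}" for p
    proof -
      have "1 + exp (Complex p q - of_real B) = of_real (1 + exp (p - B))"
        unfolding E by (simp only: of_real_add of_real_1)
      then have "norm (1 + exp (Complex p q - of_real B)) = 1 + exp (p - B)"
        using pos[of p] by (simp only: norm_of_real abs_of_pos)
      then have "norm (fermi \<alpha> B (Complex p q) * gauss \<mu> (Complex p q)) =
          exp (\<alpha> * p) / (1 + exp (p - B)) * exp (- (2 * \<mu> * p * q))"
        by (simp add: norm_mult norm_gauss fermi_def norm_divide)
      also have "\<dots> \<le> exp (\<alpha> * p) / (1 + exp (p - B)) * (1 / real n ^ 2 * exp (- (2 * c * p)))"
        using that pos[of p] by (intro mult_left_mono ex) auto
      also have "\<dots> = 1 / real n ^ 2 * f p"
        by (simp add: f_def left_diff_distrib exp_diff exp_minus field_simps)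
      finally show ?thesis .
    qed
  qed
  also have "\<dots> = integral {\<sigma>..R} f / real n ^ 2"
    by (simp only: integral_mult_right) simp
  finally have "A * norm (contour_integral (linepath (Complex \<sigma> q) (Complex R q))
               (\<lambda>t. fermi \<alpha> B t * gauss \<mu> t)) \<le> A * (integral {\<sigma>..R} f / real n ^ 2)"
    using \<alpha> by (intro mult_left_mono) auto
  also have "\<dots> = (A * integral {\<sigma>..R} f) / real n ^ 2"
    by simp
  also have "\<dots> \<le> (3 + 4 * exp ((\<alpha> - c) * B)) / real n ^ 2"
    unfolding f_def using \<alpha> \<sigma> B c
    by (intro divide_right_mono logistic_exp_integral_bound) auto
  finally show ?thesis .
qed

text \<open>The residue at height \<open>(2 * k + 1) * pi\<close> carries
  \<open>exp (- (c * B * n * (2 * k + 1)))\<close>. With \<open>c * B \<ge> 2\<close> this splits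
  into \<open>exp (- (c * B))\<close>, a factor \<open>1 / n^2\<close> and a geometric factor in
  \<open>k\<close>, so the bound is independent of \<open>K\<close>.\<close>

lemma fermi_gauss_residue_sum:
  fixes n K :: nat and \<alpha> \<sigma> B :: real
  assumes \<sigma>: "0 < \<sigma>" and n: "1 \<le> n"
  defines "\<mu> \<equiv> 2 * pi * real n / \<sigma>\<^sup>2" and "c \<equiv> 4 * pi\<^sup>2 / \<sigma>\<^sup>2"
  assumes cB: "2 \<le> c * B"
  shows "norm (\<Sum>k<K. exp (of_real \<alpha> * Complex B ((2 * real k + 1) * pi)) *
               gauss \<mu> (Complex B ((2 * real k + 1) * pi))) \<le> 2 * exp ((\<alpha> - c) * B) / real n ^ 2"
proof -
  define y where "y = c * B"
  define M where "M = exp ((\<alpha> - c) * B) / real n ^ 2"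
  have "norm (exp (of_real \<alpha> * Complex B ((2 * real k + 1) * pi)) *
      gauss \<mu> (Complex B ((2 * real k + 1) * pi))) \<le> M * (1 / 2) ^ k" for k
  proof -
    have n1: "0 \<le> real n - 1" using n by simp
    have "2 * \<mu> * B * ((2 * real k + 1) * pi) = y * real n * (2 * real k + 1)"
      by (simp add: y_def \<mu>_def c_def power2_eq_square)
    also have "\<dots> = y + y * (real n - 1) + y * (2 * real k * real n)"
      by (simp add: algebra_simps)
    also have "\<dots> \<ge> y + 2 * (real n - 1) + 1 * (real k * 1)"
      using cB [folded y_def] n n1 by (intro add_mono mult_mono mult_right_mono) auto
    finally have "exp (- (2 * \<mu> * B * ((2 * real k + 1) * pi))) \<le>
        exp (- y + - (2 * (real n - 1)) + - real k)"
      by simp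
    also have "\<dots> = exp (- (c * B)) * exp (- (2 * (real n - 1))) * exp (- 1) ^ k"
      unfolding exp_add y_def by (simp flip: exp_of_nat_mult)
    also have "\<dots> \<le> exp (- (c * B)) * (1 / real n ^ 2) * (1 / 2) ^ k"
    proof (intro mult_mono power_mono mult_left_mono)
      show "exp (- 1 :: real) \<le> 1 / 2"
        using exp_ge_add_one_self[of 1] by (simp add: exp_minus field_simps)
      show "exp (- (2 * (real n - 1))) \<le> 1 / real n ^ 2"
        using n by (intro exp_minus_bound_nat) auto
    qed auto
    finally have "exp (\<alpha> * B) * exp (- (2 * \<mu> * B * ((2 * real k + 1) * pi))) \<le>
        exp (\<alpha> * B) * (exp (- (c * B)) * (1 / real n ^ 2) * (1 / 2) ^ k)"
      by (intro mult_left_mono) auto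
    then show ?thesis
      by (simp add: norm_mult norm_gauss M_def left_diff_distrib exp_diff exp_minus field_simps)
  qed
  then have "norm (\<Sum>k<K. exp (of_real \<alpha> * Complex B ((2 * real k + 1) * pi)) *
               gauss \<mu> (Complex B ((2 * real k + 1) * pi))) \<le> (\<Sum>k<K. M * (1 / 2) ^ k)"
    by (intro sum_norm_le) auto
  also have "\<dots> = M * (\<Sum>k<K. (1 / 2) ^ k)"
    by (simp add: sum_distrib_left)
  also have "\<dots> \<le> M * 2"
    by (intro mult_left_mono) (auto simp: M_def sum_gp_strict)
  finally show ?thesis by (simp add: M_def mult.commute)
qed

text \<open>As \<open>exp (R - B) \<ge> 2\<close>, the exponential dominates the 1 in the
  denominator. Bounding the Gaussian factor by 1 is enough, because for \<alpha> < 1 the result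
  vanishes as \<open>R\<close> tends to infinity.\<close>

lemma fermi_gauss_right_edge:
  fixes n :: nat and \<alpha> B R q \<mu> :: real
  assumes "1 \<le> R - B" "0 < q" "0 \<le> \<mu>" "0 \<le> R"
  shows "norm (contour_integral (linepath (Complex R 0) (Complex R q))
               (\<lambda>t. fermi \<alpha> B t * gauss \<mu> t)) \<le> 2 * q * exp (B - (1 - \<alpha>) * R)"
proof -
  define f where "f v = fermi \<alpha> B (Complex R v) * gauss \<mu> (Complex R v)" for v
  have e2: "2 \<le> exp (R - B)"
    using exp_ge_add_one_self[of "R - B"] assms by linarith
  have lower: "exp (R - B) / 2 \<le> norm (1 + exp (Complex R v - of_real B))" for v
    using norm_triangle_ineq4[of "1 + exp (Complex R v - of_real B)" 1] e2 by simp
  then have nz: "1 + exp (Complex R v - of_real B) \<noteq> 0" for v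
    using e2 by (metis norm_zero half_gt_zero exp_gt_zero not_less)
  have bound: "norm (f v) \<le> 2 * exp (B - (1 - \<alpha>) * R)" if "0 \<le> v" for v
  proof -
    have "norm (f v) = exp (\<alpha> * R) / norm (1 + exp (Complex R v - of_real B)) * exp (- (2 * \<mu> * R * v))"
      by (simp add: f_def fermi_def norm_mult norm_gauss norm_divide)
    also have "\<dots> \<le> exp (\<alpha> * R) / (exp (R - B) / 2) * 1"
      using assms that lower by (intro mult_mono frac_le) auto
    also have "\<dots> = 2 * exp (B - (1 - \<alpha>) * R)"
      by (simp add: left_diff_distrib exp_diff)
    finally show ?thesis .
  qed
  have "norm (contour_integral (linepath (Complex R 0) (Complex R q)) (\<lambda>t. fermi \<alpha> B t * gauss \<mu> t)) =
      norm (integral {0..q} f)"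
    unfolding f_def by (subst contour_integral_linepath_same_Re [where c = R and a = 0 and b = q])
      (use assms in \<open>auto simp: norm_mult\<close>)
  also have "\<dots> \<le> 2 * exp (B - (1 - \<alpha>) * R) * q - 2 * exp (B - (1 - \<alpha>) * R) * 0"
  proof (rule norm_integral_le_antiderivative [where G' = "\<lambda>_. 2 * exp (B - (1 - \<alpha>) * R)"])
    show "continuous_on {0..q} f"
      unfolding f_def [abs_def] fermi_def gauss_def using nz unfolding Complex_eq
      by (intro continuous_intros) auto
  qed (use assms bound in \<open>auto intro!: derivative_eq_intros\<close>)
  finally show ?thesis by (simp add: mult_ac)
qed

section \<open>The estimate for the integral along the real axis\<close>

text \<open>The residue theorem expresses the bottom edge by the other edges and the poles. Only the
  last term of the bound, from the right edge, depends on \<open>R\<close> and \<open>K\<close>; it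
  disappears in the limit.\<close>

lemma Re_integral_fermi_gauss_bound:
  fixes n K :: nat and \<alpha> \<sigma> B A R :: real
  assumes \<alpha>: "0 < \<alpha>" "\<alpha> < 1" "0 \<le> A" "A \<le> \<alpha>" "A \<le> 1 - \<alpha>" and \<sigma>: "0 < \<sigma>" "\<sigma> \<le> 2 * pi * real K" "1 \<le> K"
    and B: "2 * \<sigma> \<le> B" "\<sigma> + 1 \<le> B" "B + 1 \<le> R" and n: "1 \<le> n"
  defines "\<mu> \<equiv> 2 * pi * real n / \<sigma>\<^sup>2" and "c \<equiv> 4 * pi\<^sup>2 / \<sigma>\<^sup>2"
  assumes cB: "2 \<le> c * B"
  shows "A * \<bar>Re (integral {\<sigma>..R} (\<lambda>p. fermi \<alpha> B (of_real p) * gauss \<mu> (of_real p)))\<bar> \<le>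
           21 * (exp ((\<alpha> * \<sigma>)\<^sup>2) + exp ((\<alpha> - c) * B)) / real n ^ 2
           + 4 * pi * real K * exp (B - (1 - \<alpha>) * R)"
proof -
  define q where "q = 2 * pi * real K"
  define f where "f = (\<lambda>t. fermi \<alpha> B t * gauss \<mu> t)"
  define Top where "Top = contour_integral (linepath (Complex \<sigma> q) (Complex R q)) f"
  define Rt where "Rt = contour_integral (linepath (Complex R 0) (Complex R q)) f"
  define Lt where "Lt = contour_integral (linepath (Complex \<sigma> 0) (Complex \<sigma> q)) f"
  define Bot where "Bot = contour_integral (linepath (Complex \<sigma> 0) (Complex R 0)) f"
  define Res where "Res = (\<Sum>k<K. exp (of_real \<alpha> * Complex B ((2 * real k + 1) * pi)) *
               gauss \<mu> (Complex B ((2 * real k + 1) * pi)))"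
  have \<mu>: "\<mu> \<ge> 0" by (simp add: \<mu>_def)
  have q: "q > 0" using \<sigma> unfolding q_def by (metis less_le_trans)
  have Bot: "Bot = integral {\<sigma>..R} (\<lambda>p. f (of_real p))"
    unfolding Bot_def using B \<sigma> by (subst contour_integral_linepath_same_Im) (auto simp: complex_of_real_def)
  \<comment> \<open>The vertical edges miss the line \<open>Re t = B\<close>; on a horizontal edge
    an odd multiple of \<open>pi\<close> would have to be \<open>0\<close> or
    \<open>2 * K * pi\<close>, which parity excludes.\<close>
  have nz: "1 + exp (t - of_real B) \<noteq> 0" if "t \<in> path_image (rectpath (Complex \<sigma> 0) (Complex R q))" for t
  proof
    assume "1 + exp (t - of_real B) = 0"
    then obtain l :: int where l: "t = Complex B ((2 * l + 1) * pi)"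
      by (auto simp: fermi_pole_iff)
    with that have "(2 * real_of_int l + 1) * pi = 0 \<or> (2 * real_of_int l + 1) * pi = 2 * real K * pi"
      using B \<sigma> q by (auto simp: path_image_rectpath q_def)
    then have "2 * real_of_int l + 1 = 0 \<or> 2 * real_of_int l + 1 = 2 * real K"
      by (metis mult_cancel_right mult_eq_0_iff pi_neq_zero)
    then have "2 * l + 1 = 0 \<or> 2 * l + 1 = 2 * int K" by linarith
    then show False by presburger
  qed
  have "continuous_on (path_image (rectpath (Complex \<sigma> 0) (Complex R q))) f"
    unfolding f_def using nz by (intro holomorphic_on_imp_continuous_on holomorphic_fermi_gauss)
  then have "- (2 * pi * \<i> * Res) = Bot + Rt - Top - Lt"
    unfolding Res_def Bot_def Rt_def Top_def Lt_def
    using contour_integral_fermi_gauss_rectpath[of \<sigma> B R K \<alpha> \<mu>] B \<sigma> q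
    by (subst contour_integral_rectpath [symmetric]) (auto simp: f_def q_def)
  then have "Bot = Top + Lt - Rt - 2 * pi * \<i> * Res"
    by (simp add: algebra_simps)
  then have "Re Bot = Re Top + Re Lt - Re Rt + 2 * pi * Im Res"
    by simp
  moreover have "\<bar>2 * pi * Im Res\<bar> \<le> 2 * pi * norm Res"
    by (simp add: abs_mult abs_Im_le_cmod)
  \<comment> \<open>The left edge keeps its real part, because its boundary term of order
    \<open>1 / n\<close> is imaginary; the other contributions are small in norm.\<close>
  ultimately have "\<bar>Re Bot\<bar> \<le> norm Top + \<bar>Re Lt\<bar> + norm Rt + 2 * pi * norm Res"
    using abs_Re_le_cmod[of Top] abs_Re_le_cmod[of Rt] by linarith
  then have "A * \<bar>Re Bot\<bar> \<le> A * (norm Top + \<bar>Re Lt\<bar> + norm Rt + 2 * pi * norm Res)"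
    using \<alpha> by (intro mult_left_mono) auto
  also have "\<dots> = A * norm Top + A * \<bar>Re Lt\<bar> + A * (norm Rt + 2 * pi * norm Res)"
    by (simp add: algebra_simps)
  also have "A * norm Top \<le> (3 + 4 * exp ((\<alpha> - c) * B)) / real n ^ 2"
    unfolding Top_def f_def \<mu>_def c_def q_def
    using \<alpha> \<sigma> B n by (intro fermi_gauss_top_edge) auto
  also have "A * \<bar>Re Lt\<bar> \<le> 18 * exp ((\<alpha> * \<sigma>)\<^sup>2) / real n ^ 2"
    unfolding Lt_def f_def \<mu>_def
    using \<alpha> \<sigma> B n by (intro fermi_gauss_left_edge) (auto simp: q_def)
  also have "A * (norm Rt + 2 * pi * norm Res) \<le> 1 * (norm Rt + 2 * pi * norm Res)"
    using \<alpha> by (intro mult_right_mono) (auto simp: add_nonneg_nonneg)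
  also have "norm Rt \<le> 2 * q * exp (B - (1 - \<alpha>) * R)"
    unfolding Rt_def f_def using B \<sigma> q \<mu> by (intro fermi_gauss_right_edge) auto
  also have "2 * pi * norm Res \<le> 8 * (2 * exp ((\<alpha> - c) * B) / real n ^ 2)"
    unfolding Res_def \<mu>_def c_def
    using \<sigma> n cB pi_less_4 by (intro mult_mono fermi_gauss_residue_sum) (auto simp: c_def)
  also have "(3 + 4 * exp ((\<alpha> - c) * B)) / real n ^ 2 + 18 * exp ((\<alpha> * \<sigma>)\<^sup>2) / real n ^ 2 +
      1 * (2 * q * exp (B - (1 - \<alpha>) * R) + 8 * (2 * exp ((\<alpha> - c) * B) / real n ^ 2)) =
      (3 + 18 * exp ((\<alpha> * \<sigma>)\<^sup>2) + 20 * exp ((\<alpha> - c) * B)) / real n ^ 2 + 4 * pi * real K * exp (B - (1 - \<alpha>) * R)"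
    by (simp add: q_def add_divide_distrib)
  also have "\<dots> \<le> 21 * (exp ((\<alpha> * \<sigma>)\<^sup>2) + exp ((\<alpha> - c) * B)) / real n ^ 2 + 4 * pi * real K * exp (B - (1 - \<alpha>) * R)"
  proof -
    \<comment> \<open>20 collects 4 from the top edge and \<open>8 * 2\<close> from the residues,
      where 8 bounds \<open>2 * pi\<close>. The constant 3 is absorbed by the first exponential,
      which is at least 1.\<close>
    have "3 + 18 * exp ((\<alpha> * \<sigma>)\<^sup>2) + 20 * exp ((\<alpha> - c) * B) \<le> 21 * (exp ((\<alpha> * \<sigma>)\<^sup>2) + exp ((\<alpha> - c) * B))"
      using one_le_exp_iff[of "(\<alpha> * \<sigma>)\<^sup>2"] exp_gt_zero[of "(\<alpha> - c) * B"] zero_le_power2[of "\<alpha> * \<sigma>"]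
      unfolding distrib_left by linarith
    then show ?thesis
      by (intro add_right_mono divide_right_mono) auto
  qed
  finally show ?thesis
    by (simp add: Bot f_def)
qed

section \<open>Fourier coefficients\<close>

lemma fT_nonneg:
  assumes "0 < \<alpha>" "\<alpha> < 1" "0 \<le> x" "0 \<le> u"
  shows "0 \<le> fT \<alpha> T x u"
  unfolding fT_def using assms
  by (intro mult_nonneg_nonneg divide_nonneg_nonneg add_nonneg_nonneg sin_ge_zero) auto

lemma continuous_on_fT:
  assumes "0 < \<alpha>" "0 \<le> x"
  shows "continuous_on {0<..} (fT \<alpha> T x)"
proof -
  have "exp ((sqrt u - T) / \<alpha>) + x \<noteq> 0" for u
    using assms by (metis add_pos_nonneg exp_gt_zero less_irrefl)
  then show ?thesis
    unfolding fT_def [abs_def] using assms by (intro continuous_intros) auto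
qed

text \<open>Omitting \<open>x\<close> in the denominator leaves a majorant with an elementary
  antiderivative, which makes the tails of \<open>fhat\<close> integrable. The rate
  \<open>\<delta>\<close> is positive because \<alpha> < 1.\<close>

lemma fT_le:
  assumes "0 < \<alpha>" "\<alpha> < 1" "0 \<le> x" "0 < u"
  defines "\<delta> \<equiv> 1 / \<alpha> - 1"
  shows "fT \<alpha> T x u \<le> sin (\<alpha> * pi) / (\<alpha> * pi) * x * exp (\<delta> * T) * (exp (- (\<delta> * sqrt u)) / (2 * sqrt u))"
proof -
  have "x * exp (sqrt u - T) / (exp ((sqrt u - T) / \<alpha>) + x) \<le> x * exp (sqrt u - T) / exp ((sqrt u - T) / \<alpha>)"
    using assms by (intro divide_left_mono mult_pos_pos add_pos_nonneg) auto
  also have "\<dots> = x * exp (sqrt u - T - (sqrt u - T) / \<alpha>)"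
    by (simp only: exp_diff times_divide_eq_right)
  also have "sqrt u - T - (sqrt u - T) / \<alpha> = \<delta> * T + - (\<delta> * sqrt u)"
    by (simp add: \<delta>_def algebra_simps diff_divide_distrib)
  also have "x * exp (\<delta> * T + - (\<delta> * sqrt u)) = x * exp (\<delta> * T) * exp (- (\<delta> * sqrt u))"
    by (simp only: exp_add mult.assoc)
  finally have "fT \<alpha> T x u \<le> sin (\<alpha> * pi) / (\<alpha> * pi) * (1 / (2 * sqrt u)) * (x * exp (\<delta> * T) * exp (- (\<delta> * sqrt u)))"
    unfolding fT_def using assms
    by (intro mult_left_mono mult_nonneg_nonneg divide_nonneg_nonneg sin_ge_zero) auto
  then show ?thesis by (simp add: mult_ac)
qed

text \<open>The antiderivative \<open>- exp (- (\<delta> * sqrt u)) / \<delta>\<close> tends to 0 at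
  infinity.\<close>

lemma set_integrable_exp_sqrt:
  assumes "0 < \<delta>" "0 \<le> (h::real)"
  shows "set_integrable lborel {h<..} (\<lambda>u. exp (- (\<delta> * sqrt u)) / (2 * sqrt u))"
proof -
  have "set_integrable lborel (einterval (ereal h) \<infinity>) (\<lambda>u. exp (- (\<delta> * sqrt u)) / (2 * sqrt u))"
  proof (rule interval_integral_FTC_nonneg)
    show "DERIV (\<lambda>u. - exp (- (\<delta> * sqrt u)) / \<delta>) u :> exp (- (\<delta> * sqrt u)) / (2 * sqrt u)"
      if "ereal h < ereal u" for u
      using that assms by (auto intro!: derivative_eq_intros simp: field_simps)
    show "isCont (\<lambda>u. exp (- (\<delta> * sqrt u)) / (2 * sqrt u)) u" if "ereal h < ereal u" for u
      using that assms by (auto intro!: continuous_intros)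
    show "AE u in lborel. ereal h < ereal u \<longrightarrow> ereal u < \<infinity> \<longrightarrow> 0 \<le> exp (- (\<delta> * sqrt u)) / (2 * sqrt u)"
      using assms by auto
    show "(((\<lambda>u. - exp (- (\<delta> * sqrt u)) / \<delta>) \<circ> real_of_ereal) \<longlongrightarrow> - exp (- (\<delta> * sqrt h)) / \<delta>) (at_right (ereal h))"
      unfolding ereal_tendsto_simps using assms by (intro tendsto_intros) auto
    have "filterlim (\<lambda>u. \<delta> * sqrt u) at_top at_top"
      using assms by (intro filterlim_tendsto_pos_mult_at_top [OF tendsto_const] sqrt_at_top) auto
    then have "((\<lambda>u. exp (- (\<delta> * sqrt u))) \<longlongrightarrow> 0) at_top"
      by (intro filterlim_compose [OF exp_at_bot] filterlim_compose [OF filterlim_uminus_at_bot_at_top])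
    then have "((\<lambda>u. - exp (- (\<delta> * sqrt u)) / \<delta>) \<longlongrightarrow> - 0 / \<delta>) at_top"
      using assms by (intro tendsto_intros) auto
    then show "(((\<lambda>u. - exp (- (\<delta> * sqrt u)) / \<delta>) \<circ> real_of_ereal) \<longlongrightarrow> 0) (at_left \<infinity>)"
      unfolding ereal_tendsto_simps by simp
  qed auto
  then show ?thesis by simp
qed

lemma fhat_minus: "0 < h \<Longrightarrow> fhat \<alpha> T h x (- u) = fhat \<alpha> T h x u"
  by (cases "u = - h") (auto simp: fhat_def)

lemma integrable_fhat:
  assumes \<alpha>: "0 < \<alpha>" "\<alpha> < 1" and x: "0 \<le> x" and h: "0 < h"
  shows "integrable lborel (fhat \<alpha> T h x)"
proof -
  have "set_integrable lborel {h<..} (fT \<alpha> T x)"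
  proof (rule set_integrable_bound)
    show "set_integrable lborel {h<..} (\<lambda>u. sin (\<alpha> * pi) / (\<alpha> * pi) * x * exp ((1 / \<alpha> - 1) * T) *
        (exp (- ((1 / \<alpha> - 1) * sqrt u)) / (2 * sqrt u)))"
      using \<alpha> h by (intro set_integrable_mult_right set_integrable_exp_sqrt) (auto simp: field_simps)
    show "set_borel_measurable lborel {h<..} (fT \<alpha> T x)"
      unfolding set_borel_measurable_def fT_def [abs_def] by measurable
    show "AE u in lborel. u \<in> {h<..} \<longrightarrow> norm (fT \<alpha> T x u) \<le>
        norm (sin (\<alpha> * pi) / (\<alpha> * pi) * x * exp ((1 / \<alpha> - 1) * T) *
        (exp (- ((1 / \<alpha> - 1) * sqrt u)) / (2 * sqrt u)))"
    proof (intro AE_I2 impI)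
      fix u :: real assume "u \<in> {h<..}"
      then have u: "0 < u" using h by simp
      show "norm (fT \<alpha> T x u) \<le> norm (sin (\<alpha> * pi) / (\<alpha> * pi) * x * exp ((1 / \<alpha> - 1) * T) *
        (exp (- ((1 / \<alpha> - 1) * sqrt u)) / (2 * sqrt u)))"
        using fT_le[OF \<alpha> x u, of T] fT_nonneg[OF \<alpha> x less_imp_le[OF u], of T]
        unfolding real_norm_def by linarith
    qed
  qed
  then have right: "integrable lborel (\<lambda>u. indicator {h<..} u *\<^sub>R fT \<alpha> T x u)"
    by (simp add: set_integrable_def)
  have left: "integrable lborel (\<lambda>u. indicator {h<..} (- u) *\<^sub>R fT \<alpha> T x (- u))"
    using lborel_integrable_real_affine [OF right, of "-1" 0] by simp
  have mid: "integrable lborel (\<lambda>u. indicator {-h..h} u *\<^sub>R fT \<alpha> T x h)"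
    using h by (intro integrable_scaleR_left integrable_real_indicator) auto
  \<comment> \<open>Open half-lines and a closed middle interval make the three pieces disjoint, so
    the identity holds at \<open>h\<close> and \<open>- h\<close> too.\<close>
  have "fhat \<alpha> T h x = (\<lambda>u. indicator {h<..} u *\<^sub>R fT \<alpha> T x u +
      indicator {h<..} (- u) *\<^sub>R fT \<alpha> T x (- u) + indicator {-h..h} u *\<^sub>R fT \<alpha> T x h)"
    using h by (auto simp: fhat_def fun_eq_iff indicator_def)
  then show ?thesis
    using right left mid by simp
qed

text \<open>Evenness cancels the sine part and leaves twice a half-line cosine integral. The latter
  is given as a limit over bounded intervals, because the substitution and the contour shift are
  carried out at finite length.\<close>

lemma fourier_even:
  assumes w: "integrable lborel w" and even: "\<And>u. w (- u) = w u"
  shows "Im (fourier w \<xi>) = 0"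
    and "((\<lambda>Y. 2 * integral {0..Y} (\<lambda>u. w u * cos (\<xi> * u))) \<longlongrightarrow> Re (fourier w \<xi>)) at_top"
proof -
  define c where "c = (\<lambda>u. w u * cos (\<xi> * u))"
  define s where "s = (\<lambda>u. w u * sin (\<xi> * u))"
  have [measurable]: "w \<in> borel_measurable borel"
    using w by (simp add: borel_measurable_integrable)
  have c: "integrable lborel c" and s: "integrable lborel s"
    unfolding c_def s_def
    by (rule Bochner_Integration.integrable_bound [OF w]; force simp: abs_mult intro: mult_left_le)+
  have "w u * exp (- (\<i> * complex_of_real (\<xi> * u))) = of_real (c u) - \<i> * of_real (s u)" for u
    by (simp add: c_def s_def complex_eq_iff Re_exp Im_exp)
  then have F: "fourier w \<xi> = of_real (\<integral>u. c u \<partial>lborel) - \<i> * of_real (\<integral>u. s u \<partial>lborel)"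
    unfolding fourier_def using c s by simp
  have "(\<integral>u. s u \<partial>lborel) = (\<integral>u. s (0 + (- 1) * u) \<partial>lborel)"
    by (subst lborel_integral_real_affine [of "-1" s 0]) auto
  also have "\<dots> = - (\<integral>u. s u \<partial>lborel)"
    by (simp add: s_def even)
  finally show "Im (fourier w \<xi>) = 0"
    by (simp add: F)
  have cset: "set_integrable lborel A c" if "A \<in> sets lborel" for A
    using that c unfolding set_integrable_def by (intro integrable_mult_indicator)
  have "(\<integral>u. c u \<partial>lborel) = (LINT u:{0..}|lborel. c u) + (LINT u:{..<0}|lborel. c u)"
    using cset by (subst set_integral_Un [symmetric]) (auto simp: set_lebesgue_integral_def indicator_def
        intro!: Bochner_Integration.integral_cong)
  also have "(LINT u:{..<0}|lborel. c u) = (\<integral>u. indicator {..<0} (0 + (- 1) * u) *\<^sub>R c (0 + (- 1) * u) \<partial>lborel)"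
    unfolding set_lebesgue_integral_def
    by (subst lborel_integral_real_affine [of "-1" "\<lambda>u. indicator {..<0} u *\<^sub>R c u" 0]) auto
  also have "\<dots> = (LINT u:{0..}|lborel. c u)"
    unfolding set_lebesgue_integral_def
  proof (rule integral_cong_AE)
    \<comment> \<open>The reflected half-line lacks only the point 0, a null set.\<close>
    show "AE u in lborel. indicator {..<0} (0 + - 1 * u) *\<^sub>R c (0 + - 1 * u) = indicator {0..} u *\<^sub>R c u"
      using AE_lborel_singleton[of "0::real"] by eventually_elim (auto simp: indicator_def c_def even)
  qed (auto simp: c_def)
  finally have Re: "Re (fourier w \<xi>) = 2 * (LINT u:{0..}|lborel. c u)"
    by (simp add: F)
  have "((\<lambda>Y. LINT u:{0..Y}|lborel. c u) \<longlongrightarrow> (LINT u:{0..}|lborel. c u)) at_top"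
    by (rule tendsto_set_lebesgue_integral_at_top) (auto intro: cset)
  moreover have "(LINT u:{0..Y}|lborel. c u) = integral {0..Y} c" for Y
    by (rule set_borel_integral_eq_integral) (auto intro: cset)
  ultimately show "((\<lambda>Y. 2 * integral {0..Y} (\<lambda>u. w u * cos (\<xi> * u))) \<longlongrightarrow> Re (fourier w \<xi>)) at_top"
    unfolding Re by (intro tendsto_intros) (simp add: c_def)
qed

section \<open>Reduction of the Fourier coefficients to the contour integral\<close>

text \<open>The factor \<open>2 * \<alpha>\<^sup>2 * t\<close> is the Jacobian of
  \<open>u = \<alpha>\<^sup>2 * t\<^sup>2\<close>. Writing \<open>x\<close> as
  \<open>exp (ln x)\<close> moves it into the cutoff: \<open>x\<close> factors out of the
  denominator and cancels.\<close>

lemma fT_square: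
  assumes "0 < \<alpha>" "0 < t" "0 < x"
  shows "2 * \<alpha>\<^sup>2 * t * fT \<alpha> T x (\<alpha>\<^sup>2 * t\<^sup>2) =
    sin (\<alpha> * pi) / pi * exp (- T) * (exp (\<alpha> * t) / (1 + exp (t - (T / \<alpha> + ln x))))"
proof -
  have "sqrt (\<alpha>\<^sup>2 * t\<^sup>2) = \<alpha> * t"
    using assms by (simp add: real_sqrt_mult)
  moreover have "exp ((\<alpha> * t - T) / \<alpha>) + x = x * (1 + exp (t - (T / \<alpha> + ln x)))"
  proof -
    have "exp (t - (T / \<alpha> + ln x)) = exp (t - T / \<alpha>) / x"
      using assms exp_diff [of "t - T / \<alpha>" "ln x"] by (simp add: diff_diff_eq)
    moreover have "(\<alpha> * t - T) / \<alpha> = t - T / \<alpha>"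
      using assms by (simp add: diff_divide_distrib)
    ultimately show ?thesis
      using assms by (simp add: distrib_left)
  qed
  ultimately have "fT \<alpha> T x (\<alpha>\<^sup>2 * t\<^sup>2) = sin (\<alpha> * pi) / (\<alpha> * pi) * (1 / (2 * (\<alpha> * t))) *
     (x * exp (\<alpha> * t - T) / (x * (1 + exp (t - (T / \<alpha> + ln x)))))"
    by (simp add: fT_def)
  also have "\<dots> = sin (\<alpha> * pi) / (\<alpha> * pi) * (1 / (2 * (\<alpha> * t))) *
     (exp (- T) * (exp (\<alpha> * t) / (1 + exp (t - (T / \<alpha> + ln x)))))"
  proof -
    have "exp (\<alpha> * t - T) = exp (- T) * exp (\<alpha> * t)"
      by (simp flip: exp_add)
    then show ?thesis using assms by simp
  qed
  finally show ?thesis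
    using assms by (simp add: power2_eq_square)
qed

text \<open>On \<open>[0, h]\<close> the function is constant and the cosine runs through whole
  periods, so this part integrates to 0; the substitution handles the rest. As the cosine is even,
  only the absolute value \<open>n\<close> of \<open>m\<close> matters.\<close>

lemma integral_fhat_cos:
  fixes m :: int
  assumes \<alpha>: "0 < \<alpha>" "\<alpha> < 1" and x: "0 < x" and \<sigma>: "0 < \<sigma>" "\<sigma> \<le> R" and m: "m \<noteq> 0"
  defines "h \<equiv> \<sigma>\<^sup>2 * \<alpha>\<^sup>2" and "n \<equiv> nat \<bar>m\<bar>"
  shows "integral {0..\<alpha>\<^sup>2 * R\<^sup>2} (\<lambda>u. fhat \<alpha> T h x u * cos (2 * real_of_int m * pi / h * u)) =
    sin (\<alpha> * pi) / pi * exp (- T) * Re (integral {\<sigma>..R}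
      (\<lambda>p. fermi \<alpha> (T / \<alpha> + ln x) (of_real p) * gauss (2 * pi * real n / \<sigma>\<^sup>2) (of_real p)))"
proof -
  define \<xi> where "\<xi> = 2 * real_of_int m * pi / h"
  define B where "B = T / \<alpha> + ln x"
  define \<mu> where "\<mu> = 2 * pi * real n / \<sigma>\<^sup>2"
  define g where "g = (\<lambda>u. fT \<alpha> T x u * cos (\<xi> * u))"
  define f where "f = (\<lambda>u. fhat \<alpha> T h x u * cos (\<xi> * u))"
  define I where "I = integral {\<sigma>..R} (\<lambda>p. fermi \<alpha> B (of_real p) * gauss \<mu> (of_real p))"
  have h: "h > 0" using \<sigma> \<alpha> by (simp add: h_def)
  have \<xi>: "\<xi> \<noteq> 0" using m h by (simp add: \<xi>_def)
  have hR: "h \<le> \<alpha>\<^sup>2 * R\<^sup>2"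
    unfolding h_def using \<sigma> by (subst mult.commute) (intro mult_right_mono power_mono, auto)
  have gcont: "continuous_on {h..\<alpha>\<^sup>2 * R\<^sup>2} g"
    unfolding g_def using h \<alpha> x
    by (intro continuous_intros continuous_on_subset [OF continuous_on_fT]) auto
  have "((\<lambda>u. fT \<alpha> T x h * cos (\<xi> * u)) has_integral
      (fT \<alpha> T x h * (sin (\<xi> * h) / \<xi>) - fT \<alpha> T x h * (sin (\<xi> * 0) / \<xi>))) {0..h}"
    using h \<xi> by (intro fundamental_theorem_of_calculus)
      (auto intro!: derivative_eq_intros simp flip: has_real_derivative_iff_has_vector_derivative)
  moreover have "sin (\<xi> * h) = 0"
    using h sin_zero_iff_int2 [of "\<xi> * h"] by (auto simp: \<xi>_def intro!: exI [of _ "2 * m"])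
  ultimately have "((\<lambda>u. fT \<alpha> T x h * cos (\<xi> * u)) has_integral 0) {0..h}"
    by simp
  then have 1: "(f has_integral 0) {0..h}"
    by (rule has_integral_eq [rotated]) (use h in \<open>auto simp: f_def fhat_def\<close>)
  have "(g has_integral integral {h..\<alpha>\<^sup>2 * R\<^sup>2} g) {h..\<alpha>\<^sup>2 * R\<^sup>2}"
    using gcont by (intro integrable_integral integrable_continuous_real)
  then have 2: "(f has_integral integral {h..\<alpha>\<^sup>2 * R\<^sup>2} g) {h..\<alpha>\<^sup>2 * R\<^sup>2}"
    by (rule has_integral_eq [rotated]) (auto simp: f_def g_def fhat_def)
  have fg: "integral {0..\<alpha>\<^sup>2 * R\<^sup>2} f = integral {h..\<alpha>\<^sup>2 * R\<^sup>2} g"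
    using has_integral_combine [OF _ hR 1 2] h by (simp add: integral_unique)
  have gt: "((\<lambda>t. (2 * \<alpha>\<^sup>2 * t) *\<^sub>R g (\<alpha>\<^sup>2 * t\<^sup>2)) has_integral integral {\<alpha>\<^sup>2 * \<sigma>\<^sup>2..\<alpha>\<^sup>2 * R\<^sup>2} g) {\<sigma>..R}"
  proof (rule has_integral_substitution [where c = h and d = "\<alpha>\<^sup>2 * R\<^sup>2"])
    show "(\<lambda>t. \<alpha>\<^sup>2 * t\<^sup>2) ` {\<sigma>..R} \<subseteq> {h..\<alpha>\<^sup>2 * R\<^sup>2}"
      unfolding h_def mult.commute [of "\<sigma>\<^sup>2"] using \<sigma>
      by (auto intro!: mult_left_mono power_mono)
    show "\<alpha>\<^sup>2 * \<sigma>\<^sup>2 \<le> \<alpha>\<^sup>2 * R\<^sup>2"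
      using hR by (simp add: h_def mult.commute)
  qed (use \<sigma> gcont in \<open>auto intro!: derivative_eq_intros\<close>)
  have "((\<lambda>p. fermi \<alpha> B (of_real p) * gauss \<mu> (of_real p)) has_integral I) {\<sigma>..R}"
  proof -
    have "1 + exp (complex_of_real p - of_real B) \<noteq> 0" for p
    proof -
      have "1 + exp (complex_of_real p - of_real B) = of_real (1 + exp (p - B))"
        by (simp flip: exp_of_real)
      moreover have "1 + exp (p - B) > 0" by (simp add: add_pos_pos)
      ultimately show ?thesis by (metis of_real_eq_0_iff less_irrefl)
    qed
    then show ?thesis
      unfolding I_def fermi_def gauss_def
      by (intro integrable_integral integrable_continuous_real continuous_intros) auto
  qed
  then have It: "((\<lambda>p. sin (\<alpha> * pi) / pi * exp (- T) * Re (fermi \<alpha> B (of_real p) * gauss \<mu> (of_real p)))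
      has_integral sin (\<alpha> * pi) / pi * exp (- T) * Re I) {\<sigma>..R}"
    by (intro has_integral_mult_right has_integral_Re)
  have eq: "sin (\<alpha> * pi) / pi * exp (- T) * Re (fermi \<alpha> B (of_real p) * gauss \<mu> (of_real p)) =
      (2 * \<alpha>\<^sup>2 * p) *\<^sub>R g (\<alpha>\<^sup>2 * p\<^sup>2)" if "p \<in> {\<sigma>..R}" for p
  proof -
    have p: "0 < p" using that \<sigma> by simp
    have "fermi \<alpha> B (of_real p) = of_real (exp (\<alpha> * p) / (1 + exp (p - B)))"
      by (simp add: fermi_def flip: exp_of_real)
    moreover have "gauss \<mu> (of_real p) = cis (\<mu> * p\<^sup>2)"
      by (simp add: gauss_def cis_conv_exp mult.assoc)
    moreover have "cos (\<mu> * p\<^sup>2) = cos (\<xi> * (\<alpha>\<^sup>2 * p\<^sup>2))"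
    proof -
      have "\<mu> * p\<^sup>2 = \<bar>\<xi> * (\<alpha>\<^sup>2 * p\<^sup>2)\<bar>"
        using \<alpha> \<sigma> by (simp add: \<mu>_def \<xi>_def h_def n_def abs_mult power2_eq_square)
      then show ?thesis by simp
    qed
    ultimately have Re: "Re (fermi \<alpha> B (of_real p) * gauss \<mu> (of_real p)) =
        exp (\<alpha> * p) / (1 + exp (p - B)) * cos (\<xi> * (\<alpha>\<^sup>2 * p\<^sup>2))"
      by simp
    have "sin (\<alpha> * pi) / pi * exp (- T) * Re (fermi \<alpha> B (of_real p) * gauss \<mu> (of_real p)) =
        (sin (\<alpha> * pi) / pi * exp (- T) * (exp (\<alpha> * p) / (1 + exp (p - B)))) * cos (\<xi> * (\<alpha>\<^sup>2 * p\<^sup>2))"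
      by (simp only: Re mult.assoc)
    also have "\<dots> = 2 * \<alpha>\<^sup>2 * p * fT \<alpha> T x (\<alpha>\<^sup>2 * p\<^sup>2) * cos (\<xi> * (\<alpha>\<^sup>2 * p\<^sup>2))"
      unfolding B_def by (simp only: fT_square [OF \<alpha>(1) p x])
    finally show ?thesis by (simp add: g_def)
  qed
  have "integral {\<alpha>\<^sup>2 * \<sigma>\<^sup>2..\<alpha>\<^sup>2 * R\<^sup>2} g = sin (\<alpha> * pi) / pi * exp (- T) * Re I"
    by (rule has_integral_unique [OF gt has_integral_eq [OF eq It]])
  then have "integral {0..\<alpha>\<^sup>2 * R\<^sup>2} f = sin (\<alpha> * pi) / pi * exp (- T) * Re I"
    by (simp only: fg h_def mult.commute [of "\<sigma>\<^sup>2"])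
  then show ?thesis
    by (simp add: f_def I_def \<xi>_def B_def \<mu>_def)
qed

text \<open>\<open>sin y \<le> y\<close> is applied at \<open>\<alpha> * pi\<close> and, after
  reflection, at \<open>(1 - \<alpha>) * pi\<close>. The two bounds keep the constants uniform at
  both ends of the range of \<alpha>.\<close>

lemma sin_pi_le:
  assumes "0 \<le> \<alpha>" "\<alpha> \<le> 1"
  shows "0 \<le> sin (\<alpha> * pi) / pi" "sin (\<alpha> * pi) / pi \<le> \<alpha>" "sin (\<alpha> * pi) / pi \<le> 1 - \<alpha>"
proof -
  show "0 \<le> sin (\<alpha> * pi) / pi"
    using assms by (intro divide_nonneg_nonneg sin_ge_zero) auto
  show "sin (\<alpha> * pi) / pi \<le> \<alpha>"
    using sin_x_le_x[of "\<alpha> * pi"] assms by (simp add: divide_le_eq)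
  have "sin (\<alpha> * pi) = sin ((1 - \<alpha>) * pi)"
    using sin_pi_minus[of "\<alpha> * pi"] by (simp add: algebra_simps)
  then show "sin (\<alpha> * pi) / pi \<le> 1 - \<alpha>"
    using sin_x_le_x[of "(1 - \<alpha>) * pi"] assms by (simp add: divide_le_eq)
qed

text \<open>Letting \<open>R\<close> tend to infinity removes the right edge and with it the
  dependence on \<open>K\<close>. The factor 42 is the 21 of the contour estimate, doubled by
  evenness.\<close>

lemma fourier_fhat_bound:
  fixes m :: int and \<alpha> \<sigma> T x :: real
  assumes \<alpha>: "0 < \<alpha>" "\<alpha> < 1" and x: "0 < x" and \<sigma>: "0 < \<sigma>" and m: "m \<noteq> 0"
  defines "h \<equiv> \<sigma>\<^sup>2 * \<alpha>\<^sup>2" and "B \<equiv> T / \<alpha> + ln x" and "c \<equiv> 4 * pi\<^sup>2 / \<sigma>\<^sup>2"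
  assumes B: "2 * \<sigma> \<le> B" "\<sigma> + 1 \<le> B" and cB: "2 \<le> c * B"
  shows "norm (fourier (fhat \<alpha> T h x) (2 * real_of_int m * pi / h)) \<le>
    42 * exp (- T) * (exp h + exp ((\<alpha> - c) * B)) / real_of_int m ^ 2"
proof -
  define n where "n = nat \<bar>m\<bar>"
  \<comment> \<open>The ceiling of \<open>\<sigma>\<close> meets both demands on the height of the
    rectangle, \<open>K \<ge> 1\<close> and \<open>2 * pi * K \<ge> \<sigma>\<close>.\<close>
  define K where "K = nat \<lceil>\<sigma>\<rceil>"
  define \<mu> where "\<mu> = 2 * pi * real n / \<sigma>\<^sup>2"
  define A where "A = sin (\<alpha> * pi) / pi"
  define D where "D = 21 * (exp ((\<alpha> * \<sigma>)\<^sup>2) + exp ((\<alpha> - c) * B)) / real n ^ 2"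
  define F where "F = fourier (fhat \<alpha> T h x) (2 * real_of_int m * pi / h)"
  define I where "I R = Re (integral {\<sigma>..R} (\<lambda>p. fermi \<alpha> B (of_real p) * gauss \<mu> (of_real p)))" for R
  have h: "h > 0" using \<sigma> \<alpha> by (simp add: h_def)
  have n: "1 \<le> n" using m by (simp add: n_def)
  have A: "0 \<le> A" "A \<le> \<alpha>" "A \<le> 1 - \<alpha>"
    using sin_pi_le[of \<alpha>] \<alpha> by (auto simp: A_def)
  have K: "1 \<le> K" "\<sigma> \<le> 2 * pi * real K"
  proof -
    show "1 \<le> K" using \<sigma> by (simp add: K_def Suc_le_eq)
    have "\<sigma> \<le> 1 * real K" using \<sigma> by (simp add: K_def real_nat_ceiling_ge)
    also have "\<dots> \<le> 2 * pi * real K" using pi_gt3 by (intro mult_right_mono) auto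
    finally show "\<sigma> \<le> 2 * pi * real K" .
  qed
  have Im: "Im F = 0"
    and Re: "((\<lambda>Y. 2 * integral {0..Y} (\<lambda>u. fhat \<alpha> T h x u * cos (2 * real_of_int m * pi / h * u))) \<longlongrightarrow> Re F) at_top"
    unfolding F_def using \<alpha> x h by (intro fourier_even integrable_fhat fhat_minus; simp)+
  have "filterlim (\<lambda>R. \<alpha>\<^sup>2 * R\<^sup>2) at_top at_top"
    using \<alpha> by (intro filterlim_tendsto_pos_mult_at_top [OF tendsto_const] filterlim_pow_at_top filterlim_ident) auto
  from filterlim_compose [OF Re this]
  have "((\<lambda>R. 2 * (A * exp (- T) * I R)) \<longlongrightarrow> Re F) at_top"
  proof (rule Lim_transform_eventually)
    show "\<forall>\<^sub>F R in at_top. 2 * integral {0..\<alpha>\<^sup>2 * R\<^sup>2} (\<lambda>u. fhat \<alpha> T h x u * cos (2 * real_of_int m * pi / h * u)) =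
        2 * (A * exp (- T) * I R)"
      using eventually_ge_at_top[of \<sigma>]
    proof eventually_elim
      case (elim R)
      show ?case
        unfolding h_def A_def I_def B_def \<mu>_def n_def
        using \<alpha> x \<sigma> elim m by (subst integral_fhat_cos) auto
    qed
  qed
  then have lim: "((\<lambda>R. \<bar>2 * (A * exp (- T) * I R)\<bar>) \<longlongrightarrow> \<bar>Re F\<bar>) at_top"
    by (rule tendsto_rabs)
  have "((\<lambda>R. exp (B - (1 - \<alpha>) * R)) \<longlongrightarrow> 0) at_top"
  proof -
    have "filterlim (\<lambda>R. - B + (1 - \<alpha>) * R) at_top at_top"
      using \<alpha> by (intro filterlim_tendsto_add_at_top [OF tendsto_const]
          filterlim_tendsto_pos_mult_at_top [OF tendsto_const] filterlim_ident) auto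
    from filterlim_compose [OF exp_at_bot filterlim_compose [OF filterlim_uminus_at_bot_at_top this]]
    show ?thesis by simp
  qed
  then have lim': "((\<lambda>R. 2 * exp (- T) * (D + 4 * pi * real K * exp (B - (1 - \<alpha>) * R))) \<longlongrightarrow>
      2 * exp (- T) * (D + 4 * pi * real K * 0)) at_top"
    by (intro tendsto_intros)
  have "\<bar>Re F\<bar> \<le> 2 * exp (- T) * (D + 4 * pi * real K * 0)"
  proof (rule tendsto_le [OF _ lim' lim])
    show "\<forall>\<^sub>F R in at_top. \<bar>2 * (A * exp (- T) * I R)\<bar> \<le> 2 * exp (- T) * (D + 4 * pi * real K * exp (B - (1 - \<alpha>) * R))"
      using eventually_ge_at_top[of "B + 1"]
    proof eventually_elim
      case (elim R)
      have "A * \<bar>I R\<bar> \<le> D + 4 * pi * real K * exp (B - (1 - \<alpha>) * R)"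
        unfolding I_def D_def \<mu>_def c_def using \<alpha> A \<sigma> K B elim n cB
        by (intro Re_integral_fermi_gauss_bound) (auto simp: c_def)
      then have "2 * exp (- T) * (A * \<bar>I R\<bar>) \<le> 2 * exp (- T) * (D + 4 * pi * real K * exp (B - (1 - \<alpha>) * R))"
        by (intro mult_left_mono) auto
      then show ?case
        using A by (simp add: abs_mult mult_ac)
    qed
  qed auto
  moreover have "norm F = \<bar>Re F\<bar>"
    using Im by (simp add: cmod_def)
  moreover have "2 * exp (- T) * (D + 4 * pi * real K * 0) =
      42 * exp (- T) * (exp h + exp ((\<alpha> - c) * B)) / real_of_int m ^ 2"
  proof -
    have "real n ^ 2 = real_of_int m ^ 2" "(\<alpha> * \<sigma>)\<^sup>2 = h"
      by (simp_all add: n_def h_def power_mult_distrib)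
    then show ?thesis by (simp add: D_def)
  qed
  ultimately show ?thesis
    by (simp only: F_def)
qed

section \<open>The parameter range\<close>

text \<open>The sign of \<open>r = 1 - 2 * \<alpha>\<close> decides how the quotient is estimated.
  The bounds place \<open>sqrt (ustar \<alpha>)\<close> in \<open>(1, 3]\<close>; 9 is a convenient
  perfect square above what the two cases give.\<close>

lemma ustar_bounds:
  assumes "0 < \<alpha>" "\<alpha> < 1"
  shows "1 < ustar \<alpha>" "ustar \<alpha> \<le> 9"
proof -
  define r where "r = 1 - 2 * \<alpha>"
  define s where "s = sqrt (4 * \<alpha> - 4 * \<alpha>\<^sup>2 + 1)"
  have u: "ustar \<alpha> = (1 + r * s) / (2 * (1 - \<alpha>)\<^sup>2)"
    by (simp add: ustar_def r_def s_def)
  have arg: "4 * \<alpha> - 4 * \<alpha>\<^sup>2 + 1 = 1 + 4 * (\<alpha> * (1 - \<alpha>))"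
    by (simp add: power2_eq_square algebra_simps)
  have "0 < \<alpha> * (1 - \<alpha>)" using assms by simp
  then have s1: "1 < s" unfolding s_def arg by simp
  have "\<alpha> * (1 - \<alpha>) \<le> 1 / 4"
    using zero_le_power2[of r] by (simp add: r_def power2_eq_square algebra_simps)
  then have "s \<le> sqrt 4" unfolding s_def arg by (intro real_sqrt_le_mono) auto
  then have s2: "s \<le> 2" by simp
  have ss: "s\<^sup>2 = 2 - r\<^sup>2"
    using \<open>0 < \<alpha> * (1 - \<alpha>)\<close> unfolding s_def arg
    by (simp add: r_def power2_eq_square algebra_simps)
  have "1 < ustar \<alpha> \<and> ustar \<alpha> \<le> 9"
  proof (cases "\<alpha> \<le> 1 / 2")
    case True
    have "r * 1 \<le> r * s" using True s1 by (intro mult_left_mono) (auto simp: r_def)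
    then have "2 * (1 - \<alpha>) \<le> 1 + r * s" by (simp add: r_def)
    moreover have "(1 - \<alpha>) * (1 - \<alpha>) < (1 - \<alpha>) * 1"
      using assms by (intro mult_strict_left_mono) auto
    then have "2 * (1 - \<alpha>)\<^sup>2 < 2 * (1 - \<alpha>)"
      unfolding power2_eq_square by linarith
    ultimately have "2 * (1 - \<alpha>)\<^sup>2 < 1 + r * s" by linarith
    moreover have "1 + r * s \<le> 9 * (2 * (1 - \<alpha>)\<^sup>2)"
    proof -
      have "r * s \<le> 1 * 2" using True s1 s2 assms by (intro mult_mono) (auto simp: r_def)
      moreover have "(1 / 2)\<^sup>2 \<le> (1 - \<alpha>)\<^sup>2" using True by (intro power_mono) auto
      ultimately show ?thesis by (simp add: power2_eq_square)
    qed
    ultimately show ?thesis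
      using assms by (simp add: u divide_le_eq less_divide_eq)
  next
    case False
    \<comment> \<open>Numerator and denominator of \<open>ustar\<close> both vanish as \<alpha>
      tends to 1. Multiplying by the conjugate \<open>d\<close> cancels
      \<open>2 * (1 - \<alpha>)\<^sup>2\<close> and leaves \<open>8 * \<alpha>\<^sup>2 / d\<close>
      with \<open>1 \<le> d < 2\<close>.\<close>
    define d where "d = 1 - r * s"
    have d1: "1 \<le> d" using False s1 by (simp add: d_def r_def mult_nonpos_nonneg)
    have "(r * s)\<^sup>2 = 1 - (1 - r\<^sup>2)\<^sup>2"
      by (simp add: power_mult_distrib ss) (simp add: power2_eq_square algebra_simps)
    moreover have "1 - r\<^sup>2 = 4 * (\<alpha> * (1 - \<alpha>))"
      by (simp add: r_def power2_eq_square algebra_simps)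
    ultimately have rs: "(r * s)\<^sup>2 = 1 - (4 * (\<alpha> * (1 - \<alpha>)))\<^sup>2" by simp
    have "(r * s)\<^sup>2 < 1\<^sup>2" unfolding rs using assms by simp
    then have "\<bar>r * s\<bar> < 1" by (simp only: abs_square_less_1 power_one)
    then have d2: "d < 2" by (simp add: d_def)
    have "(1 + r * s) * d = 1 - (r * s)\<^sup>2"
      by (simp add: d_def power2_eq_square algebra_simps)
    also have "\<dots> = 8 * \<alpha>\<^sup>2 * (2 * (1 - \<alpha>)\<^sup>2)"
      unfolding rs by (simp add: power_mult_distrib)
    finally have "ustar \<alpha> = 8 * \<alpha>\<^sup>2 / d"
      unfolding u using assms d1 by (simp add: field_simps)
    moreover have "8 * \<alpha>\<^sup>2 / d \<le> 8 * 1 / 1"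
      using d1 assms by (intro frac_le mult_left_mono) (auto simp: power_le_one)
    moreover have "1 < 8 * \<alpha>\<^sup>2 / d"
    proof -
      have "(1 / 2)\<^sup>2 \<le> \<alpha>\<^sup>2" using False by (intro power_mono) auto
      then have "2 \<le> 8 * \<alpha>\<^sup>2" by (simp add: power2_eq_square)
      then show ?thesis using d1 d2 by (simp add: less_divide_eq)
    qed
    ultimately show ?thesis by simp
  qed
  then show "1 < ustar \<alpha>" "ustar \<alpha> \<le> 9" by auto
qed

text \<open>With \<open>s\<close> in \<open>(1, 3]\<close> the argument of the logarithm is at least
  \<open>1 / 2\<close>, so the logarithmic term is at least \<open>- \<alpha>\<close>, which
  \<open>s > 1\<close> outweighs. This is what makes \<open>B\<close> positive on
  \<open>Upsilon\<close>.\<close>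

lemma gammastar_pos:
  assumes "0 < \<alpha>" "\<alpha> < 1"
  shows "0 < gammastar \<alpha>"
proof -
  define s where "s = sqrt (ustar \<alpha>)"
  have s1: "1 < s" using ustar_bounds(1)[OF assms] by (simp add: s_def)
  have "s \<le> sqrt 9" unfolding s_def using ustar_bounds(2)[OF assms] by (intro real_sqrt_le_mono)
  moreover have "sqrt 9 = (3 :: real)" using real_sqrt_abs[of 3] by simp
  ultimately have s3: "s \<le> 3" by simp
  define y where "y = (s / (\<alpha> / (1 - \<alpha>)) + 1) / (s - 1)"
  have y: "1 / 2 \<le> y"
    unfolding y_def using s1 s3 assms by (intro frac_le) auto
  have "- 1 \<le> ln y"
  proof -
    have "- ln 2 \<le> ln y" using y ln_le_cancel_iff [of "1 / 2" y] by (simp add: ln_div)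
    then show ?thesis using ln_2_less_1 by linarith
  qed
  then have "\<alpha> * (- 1) \<le> \<alpha> * ln y"
    using assms by (intro mult_left_mono) auto
  then have "0 < \<alpha> * ln y + s" using s1 assms by simp
  then show ?thesis
    by (simp add: gammastar_def Let_def s_def y_def)
qed

text \<open>\<open>x \<ge> xstar\<close> gives the sign of \<open>B\<close>, and the quadratic
  condition becomes \<open>B\<^sup>2 > M0 \<sigma> * \<sigma>\<^sup>2 + pi\<^sup>2\<close>. Roots of
  weaker inequalities, with \<open>M0 \<sigma> \<ge> 4\<close> and
  \<open>M0 \<sigma> \<ge> \<sigma>\<^sup>2 / 2\<close>, give what the contour estimate
  requires.\<close>

lemma Upsilon_bounds:
  fixes \<alpha> \<sigma> T x :: real
  assumes \<alpha>: "0 < \<alpha>" "\<alpha> < 1" and \<sigma>: "0 < \<sigma>" and x: "x \<in> Upsilon \<alpha> \<sigma> T (\<sigma>\<^sup>2 * \<alpha>\<^sup>2)"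
  defines "B \<equiv> T / \<alpha> + ln x"
  shows "0 < x" "2 * \<sigma> \<le> B" "\<sigma> + 1 \<le> B" "2 \<le> 4 * pi\<^sup>2 / \<sigma>\<^sup>2 * B"
proof -
  have x': "exp ((gammastar \<alpha> - T) / \<alpha>) \<le> x" "M0 \<sigma> * (\<sigma>\<^sup>2 * \<alpha>\<^sup>2) < (T + \<alpha> * ln x)\<^sup>2 - \<alpha>\<^sup>2 * pi\<^sup>2"
    using x by (auto simp: Upsilon_def xstar_def)
  show x0: "0 < x" using x'(1) exp_gt_zero less_le_trans by blast
  have "(gammastar \<alpha> - T) / \<alpha> \<le> ln x"
    using x'(1) x0 by (simp add: ln_ge_iff)
  then have "0 < B"
    using gammastar_pos[OF \<alpha>] \<alpha> by (simp add: B_def field_simps)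
  have TB: "T + \<alpha> * ln x = \<alpha> * B" using \<alpha> by (simp add: B_def field_simps)
  have "\<alpha>\<^sup>2 * (M0 \<sigma> * \<sigma>\<^sup>2) < \<alpha>\<^sup>2 * (B\<^sup>2 - pi\<^sup>2)"
    using x'(2) unfolding TB by (simp add: power_mult_distrib algebra_simps)
  then have B2: "M0 \<sigma> * \<sigma>\<^sup>2 < B\<^sup>2 - pi\<^sup>2" using \<alpha> by simp
  have M: "2 * (\<sigma>\<^sup>2 / 4) \<le> M0 \<sigma>" "2 * (2 * real_of_int \<lceil>(1 + sqrt (pi / \<sigma>)) ^ 4\<rceil>) \<le> M0 \<sigma>"
    unfolding M0_def by (intro mult_left_mono Max_ge; simp)+
  have "1 \<le> (1 + sqrt (pi / \<sigma>)) ^ 4" using \<sigma> by (intro one_le_power) auto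
  then have "1 \<le> real_of_int \<lceil>(1 + sqrt (pi / \<sigma>)) ^ 4\<rceil>"
    by (rule order_trans [OF _ le_of_int_ceiling])
  then have "4 \<le> M0 \<sigma>" using M(2) by linarith
  then have "4 * \<sigma>\<^sup>2 \<le> M0 \<sigma> * \<sigma>\<^sup>2" by (intro mult_right_mono) auto
  then have "4 * \<sigma>\<^sup>2 \<le> B\<^sup>2"
    using B2 zero_le_power2[of pi] by linarith
  then have "(2 * \<sigma>)\<^sup>2 \<le> B\<^sup>2"
    by (simp add: power_mult_distrib)
  then show 1: "2 * \<sigma> \<le> B" by (rule power2_le_imp_le) (use \<open>0 < B\<close> in simp)
  have "2\<^sup>2 \<le> pi\<^sup>2" using pi_gt3 by (intro power_mono) auto
  moreover have "0 \<le> M0 \<sigma> * \<sigma>\<^sup>2" using \<open>4 * \<sigma>\<^sup>2 \<le> M0 \<sigma> * \<sigma>\<^sup>2\<close> zero_le_power2[of \<sigma>] by linarith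
  ultimately have "2\<^sup>2 \<le> B\<^sup>2" using B2 by linarith
  then have "2 \<le> B" by (rule power2_le_imp_le) (use \<open>0 < B\<close> in simp)
  \<comment> \<open>This is the average of \<open>2 \<le> B\<close>, which stems from the
    \<open>pi\<^sup>2\<close> term, and \<open>2 * \<sigma> \<le> B\<close>.\<close>
  with 1 show "\<sigma> + 1 \<le> B" by simp
  \<comment> \<open>The entry \<open>\<sigma>\<^sup>2 / 4\<close> of the maximum makes
    \<open>B\<close> at least \<open>\<sigma>\<^sup>2 / 2\<close>, which offsets the
    \<open>1 / \<sigma>\<^sup>2\<close> in \<open>c\<close>.\<close>
  have "(\<sigma>\<^sup>2 / 2)\<^sup>2 \<le> M0 \<sigma> * \<sigma>\<^sup>2"
  proof -
    have "(\<sigma>\<^sup>2 / 2)\<^sup>2 = (\<sigma>\<^sup>2)\<^sup>2 / 4" by (simp add: power_divide)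
    also have "\<dots> \<le> (\<sigma>\<^sup>2)\<^sup>2 / 2" by (intro divide_left_mono) auto
    also have "\<dots> = 2 * (\<sigma>\<^sup>2 / 4) * \<sigma>\<^sup>2" by (simp add: power2_eq_square [of "\<sigma>\<^sup>2"])
    also have "\<dots> \<le> M0 \<sigma> * \<sigma>\<^sup>2" using M(1) by (intro mult_right_mono) auto
    finally show ?thesis .
  qed
  then have "(\<sigma>\<^sup>2 / 2)\<^sup>2 \<le> B\<^sup>2" using B2 zero_le_power2[of pi] by linarith
  then have "\<sigma>\<^sup>2 / 2 \<le> B" by (rule power2_le_imp_le) (use \<open>0 < B\<close> in simp)
  have "2 = 2\<^sup>2 * (1 / 2 :: real)" by simp
  also have "\<dots> \<le> 4 * pi\<^sup>2 / \<sigma>\<^sup>2 * (\<sigma>\<^sup>2 / 2)"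
    using \<sigma> \<open>2\<^sup>2 \<le> pi\<^sup>2\<close> by simp
  also have "\<dots> \<le> 4 * pi\<^sup>2 / \<sigma>\<^sup>2 * B"
    using \<open>\<sigma>\<^sup>2 / 2 \<le> B\<close> by (intro mult_left_mono) auto
  finally show "2 \<le> 4 * pi\<^sup>2 / \<sigma>\<^sup>2 * B" .
qed

section \<open>Summation over the frequencies\<close>

lemma summable_on_inverse_square_int: "(\<lambda>m::int. 1 / real_of_int m ^ 2) summable_on (- {0})"
proof -
  \<comment> \<open>The term at 0 is \<open>1 / 0 = 0\<close>, so all natural numbers may be
    included.\<close>
  have nat: "(\<lambda>n::nat. 1 / real n ^ 2) summable_on UNIV"
    by (rule norm_summable_imp_summable_on) (use inverse_power_summable[of 2] in \<open>simp add: inverse_eq_divide\<close>)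
  have "(\<lambda>m::int. 1 / real_of_int m ^ 2) summable_on range int"
    by (subst summable_on_reindex) (use nat in \<open>auto simp: o_def\<close>)
  moreover have "(\<lambda>m::int. 1 / real_of_int m ^ 2) summable_on range (\<lambda>n. - int n)"
    by (subst summable_on_reindex) (use nat in \<open>auto simp: o_def inj_on_def\<close>)
  ultimately have "(\<lambda>m::int. 1 / real_of_int m ^ 2) summable_on (range int \<union> range (\<lambda>n. - int n))"
    by (rule summable_on_union)
  then show ?thesis
    by (rule summable_on_subset) (auto intro: int_cases2)
qed

theorem theorem3p5:
  "\<exists>C1 C2 :: real. \<forall>(\<alpha>::real) (\<sigma>::real) (N1::nat) (x::real).
     0 < \<alpha> \<and> \<alpha> < 1 \<and> 0 < \<sigma> \<and> 1 < N1 \<and>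
     x \<in> Upsilon \<alpha> \<sigma> (\<sigma> * \<alpha> * sqrt (real N1)) (\<sigma>\<^sup>2 * \<alpha>\<^sup>2) \<longrightarrow>
     (let h = \<sigma>\<^sup>2 * \<alpha>\<^sup>2; T = \<sigma> * \<alpha> * sqrt (real N1);
          a = 2 * pi * \<alpha> * (T + \<alpha> * ln x);
          g = (\<lambda>n::int. fourier (fhat \<alpha> T h x) (2 * real_of_int n * pi / h))
      in g summable_on (- {0}) \<and>
         norm (infsum g (- {0})) \<le>
           C1 * exp h * exp (- T) + C2 * \<bar>x powr \<alpha> / (exp (2 * pi * a / h) - 1)\<bar>)"
proof -
  \<comment> \<open>An absolute number, \<open>pi\<^sup>2 / 3\<close>; both constants of the theorem
    become \<open>42 * S\<close>.\<close>
  define S where "S = infsum (\<lambda>m::int. 1 / real_of_int m ^ 2) (- {0})"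
  have S: "0 \<le> S" unfolding S_def by (intro infsum_nonneg) auto
  show ?thesis
  proof (intro exI allI impI)
    fix \<alpha> \<sigma> x :: real and N1 :: nat
    define h where "h = \<sigma>\<^sup>2 * \<alpha>\<^sup>2"
    define T where "T = \<sigma> * \<alpha> * sqrt (real N1)"
    define a where "a = 2 * pi * \<alpha> * (T + \<alpha> * ln x)"
    define g where "g = (\<lambda>n::int. fourier (fhat \<alpha> T h x) (2 * real_of_int n * pi / h))"
    define B where "B = T / \<alpha> + ln x"
    define c where "c = 4 * pi\<^sup>2 / \<sigma>\<^sup>2"
    define E where "E = x powr \<alpha> / (exp (2 * pi * a / h) - 1)"
    define D where "D = 42 * exp (- T) * (exp h + exp ((\<alpha> - c) * B))"
    assume *: "0 < \<alpha> \<and> \<alpha> < 1 \<and> 0 < \<sigma> \<and> 1 < N1 \<and>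
      x \<in> Upsilon \<alpha> \<sigma> (\<sigma> * \<alpha> * sqrt (real N1)) (\<sigma>\<^sup>2 * \<alpha>\<^sup>2)"
    then have \<alpha>: "0 < \<alpha>" "\<alpha> < 1" and \<sigma>: "0 < \<sigma>" and x: "x \<in> Upsilon \<alpha> \<sigma> T (\<sigma>\<^sup>2 * \<alpha>\<^sup>2)"
      by (auto simp: T_def)
    note b = Upsilon_bounds [OF \<alpha> \<sigma> x, folded B_def c_def]
    have TB: "T + \<alpha> * ln x = \<alpha> * B" using \<alpha> by (simp add: B_def field_simps)
    have gm: "norm (g m) \<le> D * (1 / real_of_int m ^ 2)" if "m \<in> - {0}" for m
      using fourier_fhat_bound [OF \<alpha> b(1) \<sigma>, of m T, folded B_def c_def h_def] b that
      by (simp add: g_def D_def)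
    have DS: "((\<lambda>m::int. D * (1 / real_of_int m ^ 2)) has_sum D * S) (- {0})"
      unfolding S_def by (intro has_sum_cmult_right has_sum_infsum summable_on_inverse_square_int)
    have g: "g summable_on (- {0})"
      by (rule abs_summable_summable, rule Infinite_Sum.abs_summable_on_comparison_test' [OF has_sum_imp_summable [OF DS] gm])
    have "norm (infsum g (- {0})) \<le> D * S"
      by (rule norm_infsum_le [OF has_sum_infsum [OF g] DS gm])
    also have "D * S \<le> 42 * S * exp h * exp (- T) + 42 * S * \<bar>E\<bar>"
    proof -
      \<comment> \<open>In these variables \<open>2 * pi * a / h = c * B\<close> and
        \<open>x powr \<alpha> = exp (\<alpha> * B - T)\<close>: the left side is the residue term
        of the theorem with its denominator \<open>exp (c * B) - 1\<close> enlarged to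
        \<open>exp (c * B)\<close>.\<close>
      have "exp (- T) * exp ((\<alpha> - c) * B) \<le> \<bar>E\<bar>"
      proof -
        have "2 * pi * a / h = c * B"
          using \<alpha> \<sigma> by (simp add: a_def TB h_def c_def power2_eq_square)
        moreover have "x powr \<alpha> = exp (\<alpha> * B - T)"
          using b(1) unfolding TB [symmetric] by (simp add: powr_def)
        ultimately have E: "E = exp (\<alpha> * B - T) / (exp (c * B) - 1)"
          by (simp add: E_def)
        have "1 < exp (c * B)" using b(4) by simp
        then have "exp (\<alpha> * B - T) / exp (c * B) \<le> E"
          unfolding E by (intro divide_left_mono mult_pos_pos) auto
        moreover have "exp (\<alpha> * B - T) / exp (c * B) = exp (- T) * exp ((\<alpha> - c) * B)"
          by (simp add: algebra_simps flip: exp_diff exp_add)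
        ultimately show ?thesis by linarith
      qed
      then have "42 * S * (exp (- T) * exp ((\<alpha> - c) * B)) \<le> 42 * S * \<bar>E\<bar>"
        using S by (intro mult_left_mono) auto
      then show ?thesis by (simp add: D_def algebra_simps)
    qed
    finally show "let h = \<sigma>\<^sup>2 * \<alpha>\<^sup>2; T = \<sigma> * \<alpha> * sqrt (real N1);
          a = 2 * pi * \<alpha> * (T + \<alpha> * ln x);
          g = (\<lambda>n::int. fourier (fhat \<alpha> T h x) (2 * real_of_int n * pi / h))
      in g summable_on (- {0}) \<and>
         norm (infsum g (- {0})) \<le>
           (42 * S) * exp h * exp (- T) + (42 * S) * \<bar>x powr \<alpha> / (exp (2 * pi * a / h) - 1)\<bar>"
      using g by (simp add: Let_def g_def E_def a_def h_def T_def)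
  qed
qed

end
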